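(* Let $(X,\mu)$ be a computable probability space, $n\ge 1$, and $A\subseteq\mathbb N$. If $x\in X$ is $\Pi^0_n$-generic relative to $A$, then for any $\Pi^0_n(A)$ set $P\ni x$ with $\mu(P)>0$ and any computable measure-preserving transformation $T:\subseteq X\to X$ with $x\in\operatorname{dom}T$, we have $T^k(x)\in P$ for some $k>0$.
   Context: Uniformity: a sequence of objects has a property (whose definition involves an index in $\mathbb N$) uniformly if a computable function produces suitable indices. $A^{(m)}$ denotes the $m$-th Turing jump of $A$. A computable metric space is a triple $(X,d,S)$ where $(X,d)$ is a complete separable metric space, $S=(s_i)_i$ is a dense sequence in $X$, and $d(s_i,s_j)$ is a computable real number uniformly in $i,j$. With $(q_j)_j$ a fixed enumeration of the positive rationals and $\langle\cdot,\cdot\rangle$ the standard pairing function, the ideal balls are $B_{\langle i,j\rangle}=\{x\in X: d(x,s_i)<q_j\}$. For an oracle $A\subseteq\mathbb N$: a set $U\subseteq X$ is $\Sigma^0_1(A)$ if $U=\bigcup_{i\in W}B_i$ for some $A$-c.e. $W\subseteq\mathbb N$ (its index is an index of $W$). A set is $\Pi^0_n(A)$ if its complement is $\Sigma^0_n(A)$. A set is $\Sigma^0_{n+1}(A)$ if it equals $\bigcup_{i\in W}(X\setminus U^n_i)$ for some $A$-c.e. $W\subseteq\mathbb N$, where $U^n_i$ is the $i$-th $\Sigma^0_n(A)$ set. Omit $(A)$ when $A=\emptyset$. For $D\subseteq X$, a subset of $D$ is $\Sigma^0_1$ in $D$ if it is the intersection of $D$ with a $\Sigma^0_1$ subset of $X$.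 A computable probability space $(X,\mu)$ is a computable metric space with a Borel probability measure $\mu$ such that $\mu(\bigcup_{i\in F}B_i)$ is lower-semicomputable uniformly in finite $F\subseteq\mathbb N$. A point $x\in X$ is $\Pi^0_1$-generic relative to $A$ if for any $\Pi^0_1(A)$ set $P\ni x$ there is a $\Sigma^0_1$ set $U\subseteq P$ with $\mu(U)>0$ and $x\in U$. For $n\ge 2$, $x$ is $\Pi^0_n$-generic relative to $A$ if for any $\Pi^0_n(A)$ set $P\ni x$ there is a $\Pi^0_1(A^{(n-2)})$ set $Q\subseteq P$ with $\mu(Q)>0$ and $x\in Q$. A measure-preserving transformation is a partial Borel measurable map $T:\subseteq X\to X$ such that $\mu(T^{-1}(B))=\mu(B)$ for every Borel $B$ (so $\operatorname{dom}T$ has full measure) and $x\in\operatorname{dom}T$ implies $T(x)\in\operatorname{dom}T$. It is computable if the sets $T^{-1}(B_i)$ are uniformly $\Sigma^0_1$ in $\operatorname{dom}T$. *)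

theory Defs
  imports "HOL-Probability.Probability" "HOL-Library.Nat_Bijection"
begin

section \<open>Relative computability\<close>

text \<open>
  Programs for the partial recursive functions on the natural numbers with a query set \<open>A\<close>.  All
  programs are unary; several arguments are passed through the Cantor pairing
  \<^const>\<open>prod_encode\<close>.
\<close>

datatype prog =
    PZero | PSucc | PFst | PSnd | PQuery
  | PPair prog prog | PComp prog prog | PRec prog prog | PMu prog

inductive computes :: "nat set \<Rightarrow> prog \<Rightarrow> nat \<Rightarrow> nat \<Rightarrow> bool" for A :: "nat set" where
  zero: "computes A PZero x 0"
| succ: "computes A PSucc x (Suc x)"
| fst: "computes A PFst (prod_encode (a, b)) a"
| snd: "computes A PSnd (prod_encode (a, b)) b"
| query: "computes A PQuery x (if x \<in> A then 1 else 0)"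
| pair: "computes A f x y \<Longrightarrow> computes A g x z \<Longrightarrow> computes A (PPair f g) x (prod_encode (y, z))"
| comp: "computes A g x y \<Longrightarrow> computes A f y z \<Longrightarrow> computes A (PComp f g) x z"
| rec_0: "computes A f a y \<Longrightarrow> computes A (PRec f g) (prod_encode (a, 0)) y"
| rec_Suc: "computes A (PRec f g) (prod_encode (a, m)) y \<Longrightarrow>
    computes A g (prod_encode (a, prod_encode (m, y))) z \<Longrightarrow>
    computes A (PRec f g) (prod_encode (a, Suc m)) z"
| mu: "computes A f (prod_encode (x, m)) 0 \<Longrightarrow>
    (\<And>k. k < m \<Longrightarrow> \<exists>y. computes A f (prod_encode (x, k)) (Suc y)) \<Longrightarrow>
    computes A (PMu f) x m"

inductive_cases computes_zeroE: "computes A PZero x y"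
inductive_cases computes_succE: "computes A PSucc x y"
inductive_cases computes_fstE: "computes A PFst x y"
inductive_cases computes_sndE: "computes A PSnd x y"
inductive_cases computes_queryE: "computes A PQuery x y"
inductive_cases computes_pairE: "computes A (PPair f g) x y"
inductive_cases computes_compE: "computes A (PComp f g) x y"
inductive_cases computes_recE: "computes A (PRec f g) x y"
inductive_cases computes_muE: "computes A (PMu f) x y"

lemma computes_deterministic:
  "computes A c x y \<Longrightarrow> computes A c x z \<Longrightarrow> y = z"
proof (induction arbitrary: z rule: computes.induct)
  case zero then show ?case by (auto elim: computes_zeroE)
next
  case succ then show ?case by (auto elim: computes_succE)
next
  case fst then show ?case by (auto elim: computes_fstE)
next
  case snd then show ?case by (auto elim: computes_sndE)
next
  case query then show ?case by (auto elim: computes_queryE)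
next
  case (pair f x y g w)
  from pair.prems show ?case by (rule computes_pairE) (use pair.IH in auto)
next
  case (comp g x y f w)
  from comp.prems show ?case by (rule computes_compE) (use comp.IH in blast)
next
  case (rec_0 f a y g)
  from rec_0.prems show ?case by (rule computes_recE) (use rec_0.IH in auto)
next
  case (rec_Suc f g a m y w)
  from rec_Suc.prems show ?case by (rule computes_recE) (use rec_Suc.IH in auto)
next
  case (mu f x m)
  from mu.prems show ?case
  proof (rule computes_muE)
    assume z: "computes A f (prod_encode (x, z)) 0"
      and lt: "\<And>k. k < z \<Longrightarrow> \<exists>y. computes A f (prod_encode (x, k)) (Suc y)"
    have "\<not> m < z" using mu.IH(1) lt by (metis nat.distinct(1))
    moreover have "\<not> z < m" using mu.IH(2) z by (metis nat.distinct(1))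
    ultimately show "m = z" by simp
  qed
qed

primrec goedel :: "prog \<Rightarrow> nat" where
  "goedel PZero = 0"
| "goedel PSucc = 1"
| "goedel PFst = 2"
| "goedel PSnd = 3"
| "goedel PQuery = 4"
| "goedel (PPair f g) = 5 + 4 * prod_encode (goedel f, goedel g)"
| "goedel (PComp f g) = 6 + 4 * prod_encode (goedel f, goedel g)"
| "goedel (PRec f g) = 7 + 4 * prod_encode (goedel f, goedel g)"
| "goedel (PMu f) = 8 + 4 * goedel f"

lemma goedel_inject: "goedel f = goedel g \<longleftrightarrow> f = g"
proof
  show "goedel f = goedel g \<Longrightarrow> f = g"
  proof (induction f arbitrary: g)
    case (PPair f1 f2) then show ?case by (cases g; simp) presburger+
  next
    case (PComp f1 f2) then show ?case by (cases g; simp) presburger+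
  next
    case (PRec f1 f2) then show ?case by (cases g; simp) presburger+
  next
    case (PMu f) then show ?case by (cases g; simp) presburger+
  qed (case_tac g; simp)+
qed simp

text \<open>The graph of the \<open>e\<close>-th partial \<open>A\<close>-computable function.\<close>

definition phi :: "nat set \<Rightarrow> nat \<Rightarrow> nat \<Rightarrow> nat \<Rightarrow> bool" where
  "phi A e x y \<longleftrightarrow> (\<exists>c. goedel c = e \<and> computes A c x y)"

definition ce_set :: "nat set \<Rightarrow> nat \<Rightarrow> nat set" where
  "ce_set A e = {x. \<exists>y. phi A e x y}"

definition turing_jump :: "nat set \<Rightarrow> nat set" where
  "turing_jump A = {e. e \<in> ce_set A e}"

definition computable :: "(nat \<Rightarrow> nat) \<Rightarrow> bool" where
  "computable h \<longleftrightarrow> (\<exists>e. \<forall>x. phi {} e x (h x))"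

text \<open>
  \<open>has_index e i\<close> reads: the number \<open>e\<close> is an index witnessing the property in question for
  the \<open>i\<close>-th object of the sequence.
\<close>

definition uniformly :: "(nat \<Rightarrow> nat \<Rightarrow> bool) \<Rightarrow> bool" where
  "uniformly has_index \<longleftrightarrow> (\<exists>h. computable h \<and> (\<forall>i. has_index (h i) i))"

text \<open>Effective enumerations, with repetitions, of all rationals and of the positive ones.\<close>

definition rat_enum :: "nat \<Rightarrow> real" where
  "rat_enum m = (case prod_decode m of (a, b) \<Rightarrow> real_of_int (int_decode a) / real (Suc b))"

definition pos_rat_enum :: "nat \<Rightarrow> real" where
  "pos_rat_enum m = (case prod_decode m of (a, b) \<Rightarrow> real (Suc a) / real (Suc b))"

definition computable_real_index :: "nat \<Rightarrow> real \<Rightarrow> bool" where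
  "computable_real_index e r \<longleftrightarrow> (\<forall>k. \<exists>m. phi {} e k m \<and> \<bar>r - rat_enum m\<bar> \<le> 1 / 2 ^ k)"

definition lower_semicomputable_index :: "nat \<Rightarrow> real \<Rightarrow> bool" where
  "lower_semicomputable_index e r \<longleftrightarrow> ce_set {} e = {m. rat_enum m < r}"

section \<open>Computable metric spaces and the effective Borel hierarchy\<close>

text \<open>
  The complete separable metric space is the type \<open>'a\<close> itself with its metric \<^const>\<open>dist\<close>.
\<close>

definition computable_metric_space :: "(nat \<Rightarrow> 'a::polish_space) \<Rightarrow> bool" where
  "computable_metric_space s \<longleftrightarrow>
     closure (range s) = UNIV \<and>
     uniformly (\<lambda>e p. case prod_decode p of (i, j) \<Rightarrow> computable_real_index e (dist (s i) (s j)))"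

definition ideal_ball :: "(nat \<Rightarrow> 'a::polish_space) \<Rightarrow> nat \<Rightarrow> 'a set" where
  "ideal_ball s m = (case prod_decode m of (i, j) \<Rightarrow> ball (s i) (pos_rat_enum j))"

text \<open>
  \<open>sigma0_set s A n e\<close> is the \<open>e\<close>-th set of level \<open>n\<close> relative to \<open>A\<close>.  The hierarchy starts at
  level \<open>1\<close>; the value at level \<open>0\<close> is a dummy.
\<close>

fun sigma0_set :: "(nat \<Rightarrow> 'a::polish_space) \<Rightarrow> nat set \<Rightarrow> nat \<Rightarrow> nat \<Rightarrow> 'a set" where
  "sigma0_set s A 0 e = {}"
| "sigma0_set s A (Suc 0) e = (\<Union>i\<in>ce_set A e. ideal_ball s i)"
| "sigma0_set s A (Suc (Suc n)) e = (\<Union>i\<in>ce_set A e. - sigma0_set s A (Suc n) i)"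

definition is_sigma0 :: "(nat \<Rightarrow> 'a::polish_space) \<Rightarrow> nat set \<Rightarrow> nat \<Rightarrow> 'a set \<Rightarrow> bool" where
  "is_sigma0 s A n U \<longleftrightarrow> (\<exists>e. U = sigma0_set s A n e)"

definition is_pi0 :: "(nat \<Rightarrow> 'a::polish_space) \<Rightarrow> nat set \<Rightarrow> nat \<Rightarrow> 'a set \<Rightarrow> bool" where
  "is_pi0 s A n P \<longleftrightarrow> is_sigma0 s A n (- P)"

section \<open>Computable probability spaces, genericity, computable transformations\<close>

text \<open>Finite sets of indices are given by their canonical (binary) code, see \<^const>\<open>set_decode\<close>.\<close>

definition computable_prob_space :: "(nat \<Rightarrow> 'a::polish_space) \<Rightarrow> 'a measure \<Rightarrow> bool" where
  "computable_prob_space s \<mu> \<longleftrightarrow>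
     computable_metric_space s \<and> prob_space \<mu> \<and> sets \<mu> = sets borel \<and>
     uniformly (\<lambda>e u. lower_semicomputable_index e (measure \<mu> (\<Union>i\<in>set_decode u. ideal_ball s i)))"

definition pi0_generic ::
  "(nat \<Rightarrow> 'a::polish_space) \<Rightarrow> 'a measure \<Rightarrow> nat \<Rightarrow> nat set \<Rightarrow> 'a \<Rightarrow> bool" where
  "pi0_generic s \<mu> n A x \<longleftrightarrow>
     (\<forall>P. is_pi0 s A n P \<longrightarrow> x \<in> P \<longrightarrow>
        (if n = 1
         then \<exists>U. is_sigma0 s {} 1 U \<and> U \<subseteq> P \<and> measure \<mu> U > 0 \<and> x \<in> U
         else \<exists>Q. is_pi0 s ((turing_jump ^^ (n - 2)) A) 1 Q \<and> Q \<subseteq> P \<and> measure \<mu> Q > 0 \<and> x \<in> Q))"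

text \<open>
  A partial map is given by its domain \<open>D\<close> and a total function \<open>T\<close> whose values outside \<open>D\<close> are
  irrelevant; the preimage of \<open>B\<close> under the partial map is \<open>T -` B \<inter> D\<close>.  These preimages are
  Borel subsets of the whole space, so that \<open>D\<close> itself is Borel.
\<close>

definition measure_preserving_transformation ::
  "'a::polish_space measure \<Rightarrow> 'a set \<Rightarrow> ('a \<Rightarrow> 'a) \<Rightarrow> bool" where
  "measure_preserving_transformation \<mu> D T \<longleftrightarrow>
     (\<forall>B\<in>sets borel. T -` B \<inter> D \<in> sets borel \<and> emeasure \<mu> (T -` B \<inter> D) = emeasure \<mu> B) \<and>
     (\<forall>x\<in>D. T x \<in> D)"

definition computable_transformation ::
  "(nat \<Rightarrow> 'a::polish_space) \<Rightarrow> 'a set \<Rightarrow> ('a \<Rightarrow> 'a) \<Rightarrow> bool" where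
  "computable_transformation s D T \<longleftrightarrow>
     uniformly (\<lambda>e i. T -` ideal_ball s i \<inter> D = D \<inter> sigma0_set s {} 1 e)"

end

(*
  If no iterate of x returns to P, genericity yields a set of positive measure that never returns to
  itself, contradicting Poincare recurrence.

  For n = 1, genericity puts an ideal ball B with x in B inside P.  Take a closed ball C with x in C
  inside B.  The preimages of B under the iterates of T are uniformly Sigma_1 in dom T, so C minus
  these preimages is, up to points outside dom T, a Pi_1(A) set containing x.  A Sigma_1 subset of it
  of positive measure is wandering.

  For n >= 2, genericity puts a Pi_1(A^(n-2)) set Q with x in Q inside P.  Now Q minus its preimages
  is Pi_2(A^(n-2)), and this class is contained in Pi_n(A), because a jump of the oracle costs one
  level of the hierarchy.  So genericity applies once more and yields a wandering subset.
*)

theory Submission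
  imports Defs
begin


section \<open>Computable functions\<close>

text \<open>At n = 1 genericity is applied to a set that must be Pi_1(A). An open ball need not be
  one; a closed ball is, because distances between dense points are computable. What is removed are
  preimages of the open ball, since preimages of closed sets need not be Sigma_1. At n >= 2 the set
  Q is itself closed: the preimages of its complement are open, so avoiding Q at all later times is
  a countable intersection of open conditions, which accounts for the second level. Trading jumps
  for levels has to be uniform in indices, because each level is a union over enumerated indices of
  the level below. This requires an enumeration theorem for the programs; it is obtained from
  finite, locally checkable sets of claims about computations, in which the oracle enters only
  through the answers to queries. The computed index of a preimage describes it only on
  \<open>D\<close>. Recurrence is therefore used in a form where wandering is demanded of points of
  \<open>D\<close> alone.\<close>

definition pfst :: "nat \<Rightarrow> nat" where "pfst z = fst (prod_decode z)"
definition psnd :: "nat \<Rightarrow> nat" where "psnd z = snd (prod_decode z)"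

lemma pfst_encode [simp]: "pfst (prod_encode (a, b)) = a"
  and psnd_encode [simp]: "psnd (prod_encode (a, b)) = b"
  and encode_pfst_psnd [simp]: "prod_encode (pfst z, psnd z) = z"
  by (simp_all add: pfst_def psnd_def)

definition computable_in :: "nat set \<Rightarrow> (nat \<Rightarrow> nat) \<Rightarrow> bool" where
  "computable_in A f \<longleftrightarrow> (\<exists>c. \<forall>x. computes A c x (f x))"

lemma computes_fst: "computes A PFst z (pfst z)"
  and computes_snd: "computes A PSnd z (psnd z)"
  by (metis computes.fst encode_pfst_psnd, metis computes.snd encode_pfst_psnd)

text \<open>There is no identity program; unpacking and repacking serves as one because the Cantor
  pairing is onto.\<close>

lemma computes_id: "computes A (PPair PFst PSnd) x x"
  using computes.pair[OF computes_fst computes_snd, of A x] by simp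

lemma computable_in_compose:
  assumes "computable_in A f" "computable_in A g"
  shows "computable_in A (\<lambda>x. f (g x))"
  using assms unfolding computable_in_def by (meson computes.comp)

lemma computable_in_pfst: "computable_in A f \<Longrightarrow> computable_in A (\<lambda>x. pfst (f x))"
  unfolding computable_in_def by (meson computes.comp computes_fst)

lemma computable_in_psnd: "computable_in A f \<Longrightarrow> computable_in A (\<lambda>x. psnd (f x))"
  unfolding computable_in_def by (meson computes.comp computes_snd)

lemma computable_in_Suc: "computable_in A f \<Longrightarrow> computable_in A (\<lambda>x. Suc (f x))"
  unfolding computable_in_def by (meson computes.comp computes.succ)

lemma computable_in_pair:
  "computable_in A f \<Longrightarrow> computable_in A g \<Longrightarrow> computable_in A (\<lambda>x. prod_encode (f x, g x))"
  unfolding computable_in_def by (meson computes.pair)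

lemma computable_in_id: "computable_in A (\<lambda>x. x)"
  unfolding computable_in_def using computes_id by blast

primrec const_prog :: "nat \<Rightarrow> prog" where
  "const_prog 0 = PZero"
| "const_prog (Suc n) = PComp PSucc (const_prog n)"

lemma computes_const: "computes A (const_prog n) x n"
  by (induction n) (auto intro: computes.intros)

lemma computable_in_const: "computable_in A (\<lambda>x. n)"
  unfolding computable_in_def using computes_const by blast

text \<open>\<open>PRec\<close> carries the input x along as a parameter and recurses on the second
  component, so the bound \<open>b x\<close> is supplied afterwards by composing with the map from x
  to the pair of x and \<open>b x\<close>. The step function receives its three arguments packed as
  \<open>PRec\<close> passes them.\<close>

lemma computable_in_rec_nat:
  assumes "computable_in A f"
    and "computable_in A (\<lambda>z. g (pfst z) (pfst (psnd z)) (psnd (psnd z)))"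
    and "computable_in A b"
  shows "computable_in A (\<lambda>x. rec_nat (f x) (g x) (b x))"
proof -
  obtain cf where cf: "\<And>x. computes A cf x (f x)"
    using assms(1) by (auto simp: computable_in_def)
  obtain cg where cg: "\<And>z. computes A cg z (g (pfst z) (pfst (psnd z)) (psnd (psnd z)))"
    using assms(2) by (auto simp: computable_in_def)
  have "computes A (PRec cf cg) (prod_encode (x, m)) (rec_nat (f x) (g x) m)" for x m
  proof (induction m)
    case (Suc m)
    show ?case
      using computes.rec_Suc[OF Suc cg] by simp
  qed (simp add: computes.rec_0 cf)
  then have "computable_in A (\<lambda>z. rec_nat (f (pfst z)) (g (pfst z)) (psnd z))"
    unfolding computable_in_def by (metis encode_pfst_psnd)
  from computable_in_compose[OF this computable_in_pair[OF computable_in_id assms(3)]]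
  show ?thesis by simp
qed

section \<open>Arithmetic and iteration\<close>

lemma computable_in_add:
  assumes "computable_in A f" "computable_in A g"
  shows "computable_in A (\<lambda>x. f x + g x)"
proof -
  have "rec_nat a (\<lambda>_ y. Suc y) b = a + b" for a b :: nat by (induction b) auto
  moreover have "computable_in A (\<lambda>x. rec_nat (f x) (\<lambda>_ y. Suc y) (g x))"
    by (intro computable_in_rec_nat assms computable_in_Suc computable_in_psnd computable_in_id)
  ultimately show ?thesis by simp
qed

lemma computable_in_mult:
  assumes "computable_in A f" "computable_in A g"
  shows "computable_in A (\<lambda>x. f x * g x)"
proof -
  have "rec_nat 0 (\<lambda>_ y. y + a) b = a * b" for a b :: nat by (induction b) auto
  moreover have "computable_in A (\<lambda>x. rec_nat 0 (\<lambda>_ y. y + f x) (g x))"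
    by (intro computable_in_rec_nat[where g = "\<lambda>x _ y. y + f x"] assms computable_in_add
        computable_in_const computable_in_psnd computable_in_pfst computable_in_id
        computable_in_compose[OF assms(1)])
  ultimately show ?thesis by simp
qed

lemma computable_in_power:
  assumes "computable_in A f" "computable_in A g"
  shows "computable_in A (\<lambda>x. f x ^ g x)"
proof -
  have "rec_nat 1 (\<lambda>_ y. y * a) b = a ^ b" for a b :: nat by (induction b) auto
  moreover have "computable_in A (\<lambda>x. rec_nat 1 (\<lambda>_ y. y * f x) (g x))"
    by (intro computable_in_rec_nat[where g = "\<lambda>x _ y. y * f x"] assms computable_in_mult
        computable_in_const computable_in_psnd computable_in_pfst computable_in_id
        computable_in_compose[OF assms(1)])
  ultimately show ?thesis by simp
qed

lemma computable_in_diff: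
  assumes "computable_in A f" "computable_in A g"
  shows "computable_in A (\<lambda>x. f x - g x)"
proof -
  have "rec_nat 0 (\<lambda>m _. m) b = b - 1" for b by (cases b) auto
  moreover have "computable_in A (\<lambda>x. rec_nat 0 (\<lambda>m _. m) (h x))"
    if "computable_in A h" for h
    by (intro computable_in_rec_nat that computable_in_const computable_in_psnd
        computable_in_pfst computable_in_id)
  ultimately have pred: "computable_in A (\<lambda>x. h x - 1)" if "computable_in A h" for h
    using that by simp
  have "rec_nat a (\<lambda>_ y. y - 1) b = a - b" for a b :: nat by (induction b) auto
  moreover have "computable_in A (\<lambda>x. rec_nat (f x) (\<lambda>_ y. y - 1) (g x))"
    by (intro computable_in_rec_nat assms pred computable_in_psnd computable_in_id)
  ultimately show ?thesis by simp
qed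

lemma computable_in_funpow:
  assumes "computable_in A f" "computable_in A g" "computable_in A h"
  shows "computable_in A (\<lambda>x. (f ^^ g x) (h x))"
proof -
  have "rec_nat a (\<lambda>_ y. f y) b = (f ^^ b) a" for a b by (induction b) auto
  moreover have "computable_in A (\<lambda>x. rec_nat (h x) (\<lambda>_ y. f y) (g x))"
    by (intro computable_in_rec_nat[where g = "\<lambda>_ _ y. f y"] assms
        computable_in_compose[OF assms(1)] computable_in_psnd computable_in_id)
  ultimately show ?thesis by simp
qed

text \<open>A program can do without the empty oracle: every query is answered by 0.\<close>

primrec query_free :: "prog \<Rightarrow> prog" where
  "query_free PZero = PZero"
| "query_free PSucc = PSucc"
| "query_free PFst = PFst"
| "query_free PSnd = PSnd"
| "query_free PQuery = PZero"
| "query_free (PPair f g) = PPair (query_free f) (query_free g)"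
| "query_free (PComp f g) = PComp (query_free f) (query_free g)"
| "query_free (PRec f g) = PRec (query_free f) (query_free g)"
| "query_free (PMu f) = PMu (query_free f)"

lemma computes_query_free: "computes {} c x y \<Longrightarrow> computes A (query_free c) x y"
proof (induction rule: computes.induct)
  case (mu f x m)
  then show ?case by (force intro: computes.mu)
qed (auto intro: computes.intros)

text \<open>In \<open>computable\<close> the program is chosen after the input; injectivity of
  \<open>goedel\<close> makes it the same program for all inputs.\<close>

lemma computable_imp_computable_in: "computable f \<Longrightarrow> computable_in A f"
  unfolding computable_def computable_in_def phi_def
  by (metis computes_query_free goedel_inject)

section \<open>Decidable and semidecidable predicates\<close>

definition decidable_in :: "nat set \<Rightarrow> (nat \<Rightarrow> bool) \<Rightarrow> bool" where
  "decidable_in A p \<longleftrightarrow> computable_in A (\<lambda>x. of_bool (p x))"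

lemma decidable_in_not: "decidable_in A p \<Longrightarrow> decidable_in A (\<lambda>x. \<not> p x)"
proof -
  assume "decidable_in A p"
  then have "computable_in A (\<lambda>x. 1 - of_bool (p x))"
    unfolding decidable_in_def by (rule computable_in_diff[OF computable_in_const])
  moreover have "of_bool (\<not> p x) = 1 - (of_bool (p x) :: nat)" for x by simp
  ultimately show ?thesis by (simp only: decidable_in_def)
qed

lemma decidable_in_conj:
  "decidable_in A p \<Longrightarrow> decidable_in A q \<Longrightarrow> decidable_in A (\<lambda>x. p x \<and> q x)"
  using computable_in_mult[of A "\<lambda>x. of_bool (p x)" "\<lambda>x. of_bool (q x)"]
  by (simp add: decidable_in_def of_bool_conj)

lemma decidable_in_disj:
  "decidable_in A p \<Longrightarrow> decidable_in A q \<Longrightarrow> decidable_in A (\<lambda>x. p x \<or> q x)"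
  using decidable_in_not[OF decidable_in_conj[OF decidable_in_not decidable_in_not], of A p q]
  by simp

lemma decidable_in_imp:
  "decidable_in A p \<Longrightarrow> decidable_in A q \<Longrightarrow> decidable_in A (\<lambda>x. p x \<longrightarrow> q x)"
  using decidable_in_disj[OF decidable_in_not, of A p q] by (simp only: imp_conv_disj)

lemma decidable_in_le:
  assumes "computable_in A f" "computable_in A g"
  shows "decidable_in A (\<lambda>x. f x \<le> g x)"
proof -
  have "of_bool (a \<le> b) = 1 - (a - b)" for a b :: nat by auto
  then show ?thesis
    unfolding decidable_in_def
    using computable_in_diff[OF computable_in_const[of A 1] computable_in_diff[OF assms]] by simp
qed

lemma decidable_in_less:
  assumes "computable_in A f" "computable_in A g"
  shows "decidable_in A (\<lambda>x. f x < g x)"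
  using decidable_in_le[OF computable_in_Suc[OF assms(1)] assms(2)] by (simp add: Suc_le_eq)

lemma decidable_in_eq:
  assumes "computable_in A f" "computable_in A g"
  shows "decidable_in A (\<lambda>x. f x = g x)"
  using decidable_in_conj[OF decidable_in_le[OF assms] decidable_in_le[OF assms(2,1)]]
  by (simp add: eq_iff)

lemma decidable_in_compose:
  "decidable_in A p \<Longrightarrow> computable_in A f \<Longrightarrow> decidable_in A (\<lambda>x. p (f x))"
  using computable_in_compose[of A "\<lambda>x. of_bool (p x)" f] by (simp add: decidable_in_def)

lemma decidable_in_all_less:
  assumes "decidable_in A (\<lambda>z. p (pfst z) (psnd z))" "computable_in A b"
  shows "decidable_in A (\<lambda>x. \<forall>k<b x. p x k)"
proof -
  have "rec_nat 1 (\<lambda>k y. y * of_bool (q k)) m = (of_bool (\<forall>k<m. q k) :: nat)" for q and m :: nat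
    by (induction m) (auto simp: less_Suc_eq of_bool_def)
  moreover have
    "computable_in A (\<lambda>z. of_bool (p (pfst z) (pfst (psnd z))) :: nat)"
    using computable_in_compose[OF assms(1)[unfolded decidable_in_def],
        of "\<lambda>z. prod_encode (pfst z, pfst (psnd z))"]
    by (simp add: computable_in_pair computable_in_pfst computable_in_psnd computable_in_id)
  then have "computable_in A (\<lambda>x. rec_nat 1 (\<lambda>k y. y * of_bool (p x k)) (b x))"
    by (intro computable_in_rec_nat[where g = "\<lambda>x k y. y * of_bool (p x k)"] assms(2)
        computable_in_mult computable_in_const computable_in_psnd computable_in_id)
  ultimately show ?thesis
    by (simp add: decidable_in_def)
qed

lemma decidable_in_ex_less:
  assumes "decidable_in A (\<lambda>z. p (pfst z) (psnd z))" "computable_in A b"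
  shows "decidable_in A (\<lambda>x. \<exists>k<b x. p x k)"
  using decidable_in_not[OF decidable_in_all_less[OF decidable_in_not[OF assms(1)] assms(2)]]
  by simp

lemma decidable_in_oracle:
  assumes "computable_in A f"
  shows "decidable_in A (\<lambda>x. f x \<in> A)"
proof -
  have "computes A PQuery x (of_bool (x \<in> A))" for x
    using computes.query[of A x] by (simp add: of_bool_def)
  then have "decidable_in A (\<lambda>x. x \<in> A)"
    unfolding decidable_in_def computable_in_def by blast
  from decidable_in_compose[OF this assms] show ?thesis .
qed

text \<open>Bit z of u is set iff u div 2^z is odd. Writing this as u = (2q + 1) 2^z + r with r <
  2^z turns the division into a bounded search for q and r.\<close>

lemma decidable_in_set_decode:
  assumes "computable_in A f" "computable_in A g"
  shows "decidable_in A (\<lambda>x. f x \<in> set_decode (g x))"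
proof -
  have "z \<in> set_decode u \<longleftrightarrow> (\<exists>q<Suc u. \<exists>r<2 ^ z. u = (2 * q + 1) * 2 ^ z + r)" for z u
  proof
    assume "z \<in> set_decode u"
    then have "odd (u div 2 ^ z)" by (simp add: set_decode_def)
    then obtain q where q: "u div 2 ^ z = 2 * q + 1" by (auto elim: oddE)
    have "u = (2 * q + 1) * 2 ^ z + u mod 2 ^ z"
      using div_mult_mod_eq[of u "2 ^ z"] q by simp
    moreover have "q < Suc u" using q div_le_dividend[of u "2 ^ z"] by linarith
    ultimately show "\<exists>q<Suc u. \<exists>r<2 ^ z. u = (2 * q + 1) * 2 ^ z + r"
      by (metis mod_less_divisor pos2 zero_less_power)
  next
    assume "\<exists>q<Suc u. \<exists>r<2 ^ z. u = (2 * q + 1) * 2 ^ z + r"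
    then obtain q r where "r < 2 ^ z" "u = (2 * q + 1) * 2 ^ z + r" by blast
    then have "u div 2 ^ z = 2 * q + 1" by (metis add.right_neutral div_less div_mult_self3 power_not_zero zero_neq_numeral add.commute)
    then show "z \<in> set_decode u" by (simp add: set_decode_def)
  qed
  moreover have "decidable_in A (\<lambda>x. \<exists>q<Suc (psnd x). \<exists>r<2 ^ pfst x.
      psnd x = (2 * q + 1) * 2 ^ pfst x + r)"
    by (intro decidable_in_ex_less decidable_in_eq computable_in_add computable_in_mult
        computable_in_power computable_in_const computable_in_Suc computable_in_pfst
        computable_in_psnd computable_in_id)
  ultimately have "decidable_in A (\<lambda>x. pfst x \<in> set_decode (psnd x))" by simp
  from decidable_in_compose[OF this computable_in_pair[OF assms]] show ?thesis by simp
qed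

lemmas computable_in_intros =
  computable_in_add computable_in_mult computable_in_power computable_in_diff
  computable_in_Suc computable_in_pair computable_in_pfst computable_in_psnd computable_in_id
  computable_in_const

lemmas decidable_in_intros =
  decidable_in_not decidable_in_conj decidable_in_disj decidable_in_imp decidable_in_le
  decidable_in_less decidable_in_eq decidable_in_all_less decidable_in_ex_less
  decidable_in_oracle decidable_in_set_decode

text \<open>Projections of decidable relations are chosen because closure properties then reduce to
  merging witnesses. \<open>semidecidable_in_imp_ce_set\<close> leads from here to indices; the way
  back, \<open>semidecidable_in_ce_set\<close>, needs the enumeration theorem.\<close>

definition semidecidable_in :: "nat set \<Rightarrow> (nat \<Rightarrow> bool) \<Rightarrow> bool" where
  "semidecidable_in A p \<longleftrightarrow>
     (\<exists>q. decidable_in A q \<and> (\<forall>x. p x \<longleftrightarrow> (\<exists>t. q (prod_encode (x, t)))))"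

section \<open>Closure properties of semidecidable predicates\<close>

lemma semidecidable_inI:
  assumes "decidable_in A q" "\<And>x. p x \<longleftrightarrow> (\<exists>t. q (prod_encode (x, t)))"
  shows "semidecidable_in A p"
  using assms unfolding semidecidable_in_def by blast

lemma semidecidable_in_compose:
  assumes "semidecidable_in A p" "computable_in A f"
  shows "semidecidable_in A (\<lambda>x. p (f x))"
proof -
  obtain q where q: "decidable_in A q" "\<And>x. p x \<longleftrightarrow> (\<exists>t. q (prod_encode (x, t)))"
    using assms(1) by (auto simp: semidecidable_in_def)
  have "decidable_in A (\<lambda>z. q (prod_encode (f (pfst z), psnd z)))"
    by (intro decidable_in_compose[OF q(1)] computable_in_intros computable_in_compose[OF assms(2)])
  then show ?thesis
    by (rule semidecidable_inI) (simp add: q(2))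
qed

lemma semidecidable_in_decidable:
  assumes "decidable_in A p"
  shows "semidecidable_in A p"
proof -
  have "decidable_in A (\<lambda>z. p (pfst z))"
    by (intro decidable_in_compose[OF assms] computable_in_intros)
  then show ?thesis
    by (rule semidecidable_inI) simp
qed

lemma semidecidable_in_ex:
  assumes "semidecidable_in A (\<lambda>z. p (pfst z) (psnd z))"
  shows "semidecidable_in A (\<lambda>x. \<exists>y. p x y)"
proof -
  obtain q where q: "decidable_in A q"
    "\<And>z. p (pfst z) (psnd z) \<longleftrightarrow> (\<exists>t. q (prod_encode (z, t)))"
    using assms by (auto simp: semidecidable_in_def)
  have "decidable_in A
      (\<lambda>z. q (prod_encode (prod_encode (pfst z, pfst (psnd z)), psnd (psnd z))))"
    by (intro decidable_in_compose[OF q(1)] computable_in_intros)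
  moreover have "(\<exists>y. p x y) \<longleftrightarrow>
      (\<exists>t. q (prod_encode (prod_encode (x, pfst t), psnd t)))" for x
  proof -
    have "p x y \<longleftrightarrow> (\<exists>t. q (prod_encode (prod_encode (x, y), t)))" for y
      using q(2)[of "prod_encode (x, y)"] by simp
    then show ?thesis by (metis pfst_encode psnd_encode)
  qed
  ultimately show ?thesis
    by - (rule semidecidable_inI, assumption, simp)
qed

text \<open>Finitely many witnesses have a common bound s, so only s is searched for and all other
  quantifiers are bounded.\<close>

lemma semidecidable_in_all_less:
  assumes "semidecidable_in A (\<lambda>z. p (pfst z) (psnd z))" "computable_in A b"
  shows "semidecidable_in A (\<lambda>x. \<forall>k<b x. p x k)"
proof -
  obtain q where q: "decidable_in A q"
    "\<And>z. p (pfst z) (psnd z) \<longleftrightarrow> (\<exists>t. q (prod_encode (z, t)))"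
    using assms by (auto simp: semidecidable_in_def)
  have p: "p x k \<longleftrightarrow> (\<exists>t. q (prod_encode (prod_encode (x, k), t)))" for x k
    using q(2)[of "prod_encode (x, k)"] by simp
  have "(\<forall>k<b x. p x k) \<longleftrightarrow>
      (\<exists>s. \<forall>k<b x. \<exists>t<s. q (prod_encode (prod_encode (x, k), t)))" for x
  proof
    assume "\<forall>k<b x. p x k"
    then have "\<forall>k<b x. \<exists>t. q (prod_encode (prod_encode (x, k), t))" by (simp add: p)
    then obtain t where t: "\<And>k. k < b x \<Longrightarrow> q (prod_encode (prod_encode (x, k), t k))" by metis
    have "t k < Suc (\<Sum>k<b x. t k)" if "k < b x" for k
      using that member_le_sum[of k "{..<b x}" t] by (simp add: less_Suc_eq_le)
    then show "\<exists>s. \<forall>k<b x. \<exists>t<s. q (prod_encode (prod_encode (x, k), t))"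
      using t by blast
  qed (auto simp: p)
  moreover have "decidable_in A (\<lambda>z. \<forall>k<b (pfst z). \<exists>t<psnd z.
      q (prod_encode (prod_encode (pfst z, k), t)))"
    by (intro decidable_in_intros decidable_in_compose[OF q(1)] computable_in_intros
        computable_in_compose[OF assms(2)])
  ultimately show ?thesis
    by - (rule semidecidable_inI, assumption, simp)
qed

lemma semidecidable_in_conj:
  assumes "semidecidable_in A p" "semidecidable_in A q"
  shows "semidecidable_in A (\<lambda>x. p x \<and> q x)"
proof -
  obtain p' where p': "decidable_in A p'" "\<And>x. p x \<longleftrightarrow> (\<exists>t. p' (prod_encode (x, t)))"
    using assms(1) by (auto simp: semidecidable_in_def)
  obtain q' where q': "decidable_in A q'" "\<And>x. q x \<longleftrightarrow> (\<exists>t. q' (prod_encode (x, t)))"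
    using assms(2) by (auto simp: semidecidable_in_def)
  have "decidable_in A (\<lambda>z. p' (prod_encode (pfst z, pfst (psnd z))) \<and>
      q' (prod_encode (pfst z, psnd (psnd z))))"
    by (intro decidable_in_conj decidable_in_compose[OF p'(1)] decidable_in_compose[OF q'(1)]
        computable_in_intros)
  moreover have "p x \<and> q x \<longleftrightarrow>
      (\<exists>t. p' (prod_encode (x, pfst t)) \<and> q' (prod_encode (x, psnd t)))" for x
    unfolding p'(2) q'(2) by (metis pfst_encode psnd_encode)
  ultimately show ?thesis
    by - (rule semidecidable_inI, assumption, simp)
qed

lemma semidecidable_in_disj:
  assumes "semidecidable_in A p" "semidecidable_in A q"
  shows "semidecidable_in A (\<lambda>x. p x \<or> q x)"
proof -
  obtain p' where p': "decidable_in A p'" "\<And>x. p x \<longleftrightarrow> (\<exists>t. p' (prod_encode (x, t)))"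
    using assms(1) by (auto simp: semidecidable_in_def)
  obtain q' where q': "decidable_in A q'" "\<And>x. q x \<longleftrightarrow> (\<exists>t. q' (prod_encode (x, t)))"
    using assms(2) by (auto simp: semidecidable_in_def)
  show ?thesis
    by (rule semidecidable_inI[OF decidable_in_disj[OF p'(1) q'(1)]]) (auto simp: p'(2) q'(2))
qed

lemma semidecidable_in_imp:
  assumes "decidable_in A p" "semidecidable_in A q"
  shows "semidecidable_in A (\<lambda>x. p x \<longrightarrow> q x)"
  using semidecidable_in_disj[OF semidecidable_in_decidable[OF decidable_in_not[OF assms(1)]] assms(2)]
  by (simp only: imp_conv_disj)

text \<open>Unbounded search for a witness halts exactly where \<open>p\<close> holds. The
  characteristic function is negated because \<open>PMu\<close> looks for the value 0.\<close>

lemma semidecidable_in_imp_ce_set: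
  assumes "semidecidable_in A p"
  shows "\<exists>e. ce_set A e = Collect p"
proof -
  obtain q where q: "decidable_in A q" "\<And>x. p x \<longleftrightarrow> (\<exists>t. q (prod_encode (x, t)))"
    using assms by (auto simp: semidecidable_in_def)
  obtain c where c: "\<And>x. computes A c x (of_bool (\<not> q x))"
    using decidable_in_not[OF q(1)] by (auto simp: decidable_in_def computable_in_def)
  have "(\<exists>y. computes A (PMu c) x y) \<longleftrightarrow> p x" for x
  proof
    assume "\<exists>y. computes A (PMu c) x y"
    then obtain m where "computes A c (prod_encode (x, m)) 0"
      by (auto elim: computes_muE)
    with c have "of_bool (\<not> q (prod_encode (x, m))) = (0::nat)"
      by (rule computes_deterministic)
    then show "p x" by (auto simp: q(2))
  next
    assume "p x"
    define m where "m = (LEAST m. q (prod_encode (x, m)))"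
    have "q (prod_encode (x, m))"
      using \<open>p x\<close> unfolding m_def q(2) by (rule LeastI_ex)
    moreover have "\<not> q (prod_encode (x, k))" if "k < m" for k
      using that unfolding m_def by (rule not_less_Least)
    ultimately have "computes A c (prod_encode (x, m)) 0"
      and "\<And>k. k < m \<Longrightarrow> computes A c (prod_encode (x, k)) (Suc 0)"
      using c by (metis of_bool_eq(1), metis of_bool_eq(2) One_nat_def)
    then have "computes A (PMu c) x m"
      by (blast intro: computes.mu)
    then show "\<exists>y. computes A (PMu c) x y" ..
  qed
  then have "ce_set A (goedel (PMu c)) = Collect p"
    unfolding ce_set_def phi_def goedel_inject by simp
  then show ?thesis ..
qed

text \<open>The new index is that of a fixed program composed with one that pairs the constant y
  with its input. Only syntax is manipulated, so \<open>h\<close> is computable in every oracle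
  \<open>B\<close>, even though the sets are enumerated with \<open>A\<close>; this matters when
  \<open>A\<close> is the jump of \<open>B\<close>.\<close>

lemma smn:
  assumes "semidecidable_in A (\<lambda>z. p (pfst z) (psnd z))"
  shows "\<exists>h. (\<forall>B. computable_in B h) \<and> (\<forall>y. ce_set A (h y) = {x. p y x})"
proof -
  obtain e where e: "ce_set A e = {z. p (pfst z) (psnd z)}"
    using semidecidable_in_imp_ce_set[OF assms] by blast
  show ?thesis
  proof (cases "\<exists>c. goedel c = e")
    case False
    then have "ce_set A e = {}" by (simp add: ce_set_def phi_def)
    with e have "\<And>x y. \<not> p y x" by (metis empty_Collect_eq pfst_encode psnd_encode)
    with \<open>ce_set A e = {}\<close> show ?thesis
      by (intro exI[of _ "\<lambda>_. e"]) (simp add: computable_in_const)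
  next
    case True
    then obtain c where c: "goedel c = e" ..
    define i where "i = goedel (PPair PFst PSnd)"
    \<comment> \<open>This mirrors \<open>const_prog\<close>: 6 + 4 * ... is the code of
      \<open>PComp\<close>, 1 that of \<open>PSucc\<close>, and the start value 0 that of
      \<open>PZero\<close>.\<close>
    define k where "k n = rec_nat 0 (\<lambda>_ r. 6 + 4 * prod_encode (1, r)) n" for n
    have k: "goedel (const_prog n) = k n" for n
      by (induction n) (auto simp: k_def)
    define h where "h n = 6 + 4 * prod_encode (e, 5 + 4 * prod_encode (k n, i))" for n
    have h: "h n = goedel (PComp c (PPair (const_prog n) (PPair PFst PSnd)))" for n
      by (simp add: h_def k i_def c)
    have "computable_in B k" for B
      unfolding k_def
      by (intro computable_in_rec_nat[where g = "\<lambda>_ _ r. 6 + 4 * prod_encode (1, r)"] computable_in_intros)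
    then have "computable_in B h" for B
      unfolding h_def by (intro computable_in_intros)
    moreover have "x \<in> ce_set A (h y) \<longleftrightarrow> prod_encode (y, x) \<in> ce_set A e" for x y
    proof -
      have "computes A (PPair (const_prog y) (PPair PFst PSnd)) x (prod_encode (y, x))"
        by (intro computes.pair computes_const computes_id)
      then have "(\<exists>w. computes A (PComp c (PPair (const_prog y) (PPair PFst PSnd))) x w) \<longleftrightarrow>
          (\<exists>w. computes A c (prod_encode (y, x)) w)"
        by (metis computes.comp computes_compE computes_deterministic)
      then show ?thesis
        unfolding ce_set_def phi_def h c[symmetric] goedel_inject by simp
    qed
    ultimately show ?thesis
      using e by (intro exI[of _ h]) auto
  qed
qed


section \<open>Computation traces and the universal machine\<close>

text \<open>From 5 on, the residue of e - 5 modulo 4 selects the compound constructor, and the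
  quotient d is below e and bounds both of its Cantor components. Thus every number in a claim
  stands for a program.\<close>

lemma goedel_surj: "\<exists>c. goedel c = e"
proof (induction e rule: less_induct)
  case (less e)
  show ?case
  proof (cases "e < 5")
    case True
    then consider "e = 0" | "e = 1" | "e = 2" | "e = 3" | "e = 4" by linarith
    then show ?thesis by cases (metis goedel.simps)+
  next
    case False
    define d where "d = (e - 5) div 4"
    have "e = 5 + 4 * d + (e - 5) mod 4"
      using False by (simp add: d_def)
    moreover have "(e - 5) mod 4 < 4" by simp
    ultimately consider "e = 5 + 4 * d" | "e = 6 + 4 * d" | "e = 7 + 4 * d" | "e = 8 + 4 * d"
      by linarith
    moreover have "pfst d \<le> d" "psnd d \<le> d"
      by (metis encode_pfst_psnd le_prod_encode_1, metis encode_pfst_psnd le_prod_encode_2)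
    moreover have "d < e" using False by (auto simp: d_def)
    ultimately show ?thesis
      using less[of "pfst d"] less[of "psnd d"] less[of d]
      by (metis encode_pfst_psnd goedel.simps(6-9) le_less_trans)
  qed
qed

definition entry :: "nat \<Rightarrow> nat \<Rightarrow> nat \<Rightarrow> nat" where
  "entry e x y = prod_encode (e, prod_encode (x, y))"

lemma entry_eq_iff [simp]: "entry e x y = entry e' x' y' \<longleftrightarrow> e = e' \<and> x = x' \<and> y = y'"
  by (simp add: entry_def)

lemma entry_surj: "entry (pfst z) (pfst (psnd z)) (psnd (psnd z)) = z"
  by (simp add: entry_def)

text \<open>
  A trace is a set of claims ``program \<open>e\<close> maps \<open>x\<close> to \<open>y\<close>'' each of which follows from others by
  a rule of \<^const>\<open>computes\<close>.  No order on the claims is needed to exclude circular justifications,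
  since the program, or else the recursion argument, gets smaller.  The numbers below are those of
  \<^const>\<open>goedel\<close>.
\<close>

definition justified :: "nat set \<Rightarrow> nat \<Rightarrow> nat \<Rightarrow> nat \<Rightarrow> bool" where
  "justified L e x y \<longleftrightarrow>
     e = 0 \<and> y = 0 \<or> e = 1 \<and> y = Suc x \<or> e = 2 \<and> y = pfst x \<or> e = 3 \<and> y = psnd x \<or> e = 4 \<and> y < 2 \<or>
     (\<exists>f g a b. e = 5 + 4 * prod_encode (f, g) \<and> y = prod_encode (a, b) \<and>
        entry f x a \<in> L \<and> entry g x b \<in> L) \<or>
     (\<exists>f g a. e = 6 + 4 * prod_encode (f, g) \<and> entry g x a \<in> L \<and> entry f a y \<in> L) \<or>
     (\<exists>f g a. e = 7 + 4 * prod_encode (f, g) \<and> x = prod_encode (a, 0) \<and> entry f a y \<in> L) \<or>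
     (\<exists>f g a m b. e = 7 + 4 * prod_encode (f, g) \<and> x = prod_encode (a, Suc m) \<and>
        entry e (prod_encode (a, m)) b \<in> L \<and>
        entry g (prod_encode (a, prod_encode (m, b))) y \<in> L) \<or>
     (\<exists>f. e = 8 + 4 * f \<and> entry f (prod_encode (x, y)) 0 \<in> L \<and>
        (\<forall>k<y. \<exists>v. entry f (prod_encode (x, k)) (Suc v) \<in> L))"

definition is_trace :: "nat set \<Rightarrow> bool" where
  "is_trace L \<longleftrightarrow> (\<forall>e x y. entry e x y \<in> L \<longrightarrow> justified L e x y)"

text \<open>Kept apart from \<open>justified\<close>, which accepts either bit as an answer: being a
  trace does not depend on the oracle, so the oracle can later be replaced by a jump.\<close>

definition correct_queries :: "nat set \<Rightarrow> nat set \<Rightarrow> bool" where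
  "correct_queries A L \<longleftrightarrow> (\<forall>x y. entry 4 x y \<in> L \<longrightarrow> y = of_bool (x \<in> A))"

lemma justified_pair:
  "entry f x a \<in> L \<Longrightarrow> entry g x b \<in> L \<Longrightarrow>
     justified L (5 + 4 * prod_encode (f, g)) x (prod_encode (a, b))"
  unfolding justified_def by blast

lemma justified_comp:
  "entry g x a \<in> L \<Longrightarrow> entry f a y \<in> L \<Longrightarrow> justified L (6 + 4 * prod_encode (f, g)) x y"
  unfolding justified_def by blast

lemma justified_rec_0:
  "entry f a y \<in> L \<Longrightarrow> justified L (7 + 4 * prod_encode (f, g)) (prod_encode (a, 0)) y"
  unfolding justified_def by blast

lemma justified_rec_Suc:
  "entry (7 + 4 * prod_encode (f, g)) (prod_encode (a, m)) b \<in> L \<Longrightarrow>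
     entry g (prod_encode (a, prod_encode (m, b))) y \<in> L \<Longrightarrow>
     justified L (7 + 4 * prod_encode (f, g)) (prod_encode (a, Suc m)) y"
  unfolding justified_def by blast

lemma justified_mu:
  "entry f (prod_encode (x, y)) 0 \<in> L \<Longrightarrow>
     (\<And>k. k < y \<Longrightarrow> entry f (prod_encode (x, k)) (Suc (v k)) \<in> L) \<Longrightarrow>
     justified L (8 + 4 * f) x y"
  unfolding justified_def by (intro disjI2 exI[of _ f]) auto

lemma justified_mono: "justified L e x y \<Longrightarrow> L \<subseteq> L' \<Longrightarrow> justified L' e x y"
  unfolding justified_def
  by (elim disjE conjE exE) (auto; (blast | metis subsetD))+

lemma trace_Union: "(\<And>L. L \<in> C \<Longrightarrow> is_trace L) \<Longrightarrow> is_trace (\<Union>C)"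
  unfolding is_trace_def by (meson Union_iff Sup_upper justified_mono)

lemma trace_insert: "is_trace L \<Longrightarrow> justified L e x y \<Longrightarrow> is_trace (insert (entry e x y) L)"
  unfolding is_trace_def by (metis insert_iff entry_eq_iff justified_mono subset_insertI)

lemma trace_sound:
  assumes "is_trace L" "correct_queries A L" "entry (goedel c) x y \<in> L"
  shows "computes A c x y"
  using assms(3)
proof (induction c arbitrary: x y)
  case PZero
  then have "justified L 0 x y" using assms(1) by (simp add: is_trace_def)
  then show ?case by (auto simp: justified_def intro: computes.zero)
next
  case PSucc
  then have "justified L 1 x y" using assms(1) by (simp add: is_trace_def)
  then show ?case by (auto simp: justified_def intro: computes.succ)
next
  case PFst
  then have "justified L 2 x y" using assms(1) by (simp add: is_trace_def)
  then show ?case by (auto simp: justified_def intro: computes_fst)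
next
  case PSnd
  then have "justified L 3 x y" using assms(1) by (simp add: is_trace_def)
  then show ?case by (auto simp: justified_def intro: computes_snd)
next
  case PQuery
  then have "y = (if x \<in> A then 1 else 0)"
    using assms(2) by (simp add: correct_queries_def of_bool_def)
  then show ?case by (simp only: computes.query)
next
  case (PPair f g)
  then have "justified L (5 + 4 * prod_encode (goedel f, goedel g)) x y"
    using assms(1) by (simp add: is_trace_def)
  \<comment> \<open>The other rules are excluded by the size of the program number or its residue
    modulo 4.\<close>
  then obtain a b where "y = prod_encode (a, b)" "entry (goedel f) x a \<in> L" "entry (goedel g) x b \<in> L"
    unfolding justified_def by (elim disjE exE conjE) (simp_all, presburger+)
  then show ?case using PPair.IH by (blast intro: computes.pair)
next
  case (PComp f g)
  then have "justified L (6 + 4 * prod_encode (goedel f, goedel g)) x y"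
    using assms(1) by (simp add: is_trace_def)
  then obtain a where "entry (goedel g) x a \<in> L" "entry (goedel f) a y \<in> L"
    unfolding justified_def by (elim disjE exE conjE) (simp_all, presburger+)
  then show ?case using PComp.IH by (blast intro: computes.comp)
next
  case (PRec f g)
  \<comment> \<open>The premise about the preceding stage names the same program, hence an inner
    induction on the recursion counter.\<close>
  have "computes A (PRec f g) (prod_encode (a, m)) y"
    if "entry (goedel (PRec f g)) (prod_encode (a, m)) y \<in> L" for a m y
    using that
  proof (induction m arbitrary: y)
    case 0
    then have "justified L (7 + 4 * prod_encode (goedel f, goedel g)) (prod_encode (a, 0)) y"
      using assms(1) by (simp add: is_trace_def)
    then have "entry (goedel f) a y \<in> L"
      unfolding justified_def by (elim disjE exE conjE) (simp_all, presburger+)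
    then show ?case using PRec.IH by (blast intro: computes.rec_0)
  next
    case (Suc m)
    then have "justified L (7 + 4 * prod_encode (goedel f, goedel g)) (prod_encode (a, Suc m)) y"
      using assms(1) by (simp add: is_trace_def)
    then obtain b where "entry (goedel (PRec f g)) (prod_encode (a, m)) b \<in> L"
        "entry (goedel g) (prod_encode (a, prod_encode (m, b))) y \<in> L"
      unfolding justified_def by (elim disjE exE conjE) (simp_all, presburger+)
    then show ?case using PRec.IH Suc.IH by (blast intro: computes.rec_Suc)
  qed
  from this[of "pfst x" "psnd x" y] PRec.prems show ?case by simp
next
  case (PMu f)
  then have "justified L (8 + 4 * goedel f) x y"
    using assms(1) by (simp add: is_trace_def)
  then have *: "entry (goedel f) (prod_encode (x, y)) 0 \<in> L \<and>
      (\<forall>k<y. \<exists>v. entry (goedel f) (prod_encode (x, k)) (Suc v) \<in> L)"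
    unfolding justified_def by (elim disjE exE conjE) (simp_all, presburger+)
  show ?case
  proof (rule computes.mu)
    show "computes A f (prod_encode (x, y)) 0"
      using * by (intro PMu.IH) blast
    show "\<exists>v. computes A f (prod_encode (x, k)) (Suc v)" if "k < y" for k
      using * that PMu.IH by meson
  qed
qed

text \<open>One rule of \<^const>\<open>computes\<close>: \<open>C\<close> lists the claims made by its premises.\<close>

lemma trace_extend:
  assumes "finite C"
    and "\<And>e x y. (e, x, y) \<in> C \<Longrightarrow>
      \<exists>L. finite L \<and> is_trace L \<and> correct_queries A L \<and> entry e x y \<in> L"
    and "\<And>L. (\<And>e x y. (e, x, y) \<in> C \<Longrightarrow> entry e x y \<in> L) \<Longrightarrow> justified L e x y"
    and "e = 4 \<Longrightarrow> y = of_bool (x \<in> A)"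
  shows "\<exists>L. finite L \<and> is_trace L \<and> correct_queries A L \<and> entry e x y \<in> L"
proof -
  have "\<forall>w\<in>C. \<exists>L. finite L \<and> is_trace L \<and> correct_queries A L \<and>
      (case w of (e, x, y) \<Rightarrow> entry e x y \<in> L)"
    using assms(2) by auto
  then obtain F where F: "\<And>w. w \<in> C \<Longrightarrow> finite (F w) \<and> is_trace (F w) \<and> correct_queries A (F w) \<and>
      (case w of (e, x, y) \<Rightarrow> entry e x y \<in> F w)"
    by metis
  define L where "L = \<Union>(F ` C)"
  have "is_trace L"
    unfolding L_def using F by (intro trace_Union) auto
  moreover have "justified L e x y"
    using F by (intro assms(3)) (force simp: L_def)
  ultimately have "is_trace (insert (entry e x y) L)"
    by (rule trace_insert)
  moreover have "finite L"
    using F assms(1) by (auto simp: L_def)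
  moreover have "correct_queries A L"
    using F unfolding L_def correct_queries_def by blast
  ultimately have "finite (insert (entry e x y) L)" "correct_queries A (insert (entry e x y) L)"
    using assms(4) by (auto simp: correct_queries_def)
  with \<open>is_trace (insert (entry e x y) L)\<close> show ?thesis by blast
qed

lemma trace_complete:
  "computes A c x y \<Longrightarrow>
     \<exists>L. finite L \<and> is_trace L \<and> correct_queries A L \<and> entry (goedel c) x y \<in> L"
proof (induction rule: computes.induct)
  case (zero x)
  show ?case by (rule trace_extend[of "{}"]) (auto simp: justified_def)
next
  case (succ x)
  show ?case by (rule trace_extend[of "{}"]) (auto simp: justified_def)
next
  case (fst a b)
  show ?case by (rule trace_extend[of "{}"]) (auto simp: justified_def)
next
  case (snd a b)
  show ?case by (rule trace_extend[of "{}"]) (auto simp: justified_def)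
next
  case (query x)
  show ?case by (rule trace_extend[of "{}"]) (auto simp: justified_def)
next
  case (pair f x y g z)
  show ?case
    by (rule trace_extend[of "{(goedel f, x, y), (goedel g, x, z)}"])
      (use pair.IH in \<open>auto intro: justified_pair\<close>)
next
  case (comp g x y f z)
  show ?case
    by (rule trace_extend[of "{(goedel g, x, y), (goedel f, y, z)}"])
      (use comp.IH in \<open>auto intro: justified_comp\<close>)
next
  case (rec_0 f a y g)
  show ?case
    by (rule trace_extend[of "{(goedel f, a, y)}"])
      (use rec_0.IH in \<open>auto intro: justified_rec_0\<close>)
next
  case (rec_Suc f g a m y z)
  show ?case
    by (rule trace_extend[of "{(goedel (PRec f g), prod_encode (a, m), y),
          (goedel g, prod_encode (a, prod_encode (m, y)), z)}"])
      (use rec_Suc.IH in \<open>auto intro: justified_rec_Suc\<close>)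
next
  case (mu f x m)
  \<comment> \<open>One value is fixed for each k < m, so that finitely many claims justify the
    search.\<close>
  then obtain v where v: "\<And>k. k < m \<Longrightarrow> \<exists>L. finite L \<and> is_trace L \<and> correct_queries A L \<and>
      entry (goedel f) (prod_encode (x, k)) (Suc (v k)) \<in> L"
    by metis
  show ?case
    by (rule trace_extend[of "insert (goedel f, prod_encode (x, m), 0)
          ((\<lambda>k. (goedel f, prod_encode (x, k), Suc (v k))) ` {..<m})"])
      (use mu.IH(1) v in \<open>auto intro!: justified_mu[of _ _ _ _ v]\<close>)
qed

text \<open>A form of Kleene's normal form theorem: u codes a finite certificate of the
  computation.\<close>

lemma phi_iff_trace:
  "phi A e x y \<longleftrightarrow>
     (\<exists>u. is_trace (set_decode u) \<and> correct_queries A (set_decode u) \<and> entry e x y \<in> set_decode u)"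
proof
  assume "phi A e x y"
  then obtain L where "finite L" "is_trace L" "correct_queries A L" "entry e x y \<in> L"
    unfolding phi_def using trace_complete by blast
  then show "\<exists>u. is_trace (set_decode u) \<and> correct_queries A (set_decode u) \<and>
      entry e x y \<in> set_decode u"
    by (intro exI[of _ "set_encode L"]) simp
next
  assume "\<exists>u. is_trace (set_decode u) \<and> correct_queries A (set_decode u) \<and>
      entry e x y \<in> set_decode u"
  moreover obtain c where "goedel c = e" using goedel_surj by blast
  ultimately show "phi A e x y"
    unfolding phi_def using trace_sound by blast
qed

text \<open>This lets quantifiers over the members of a coded set be bounded by its code.\<close>

lemma less_of_mem_set_decode: "z \<in> set_decode u \<Longrightarrow> z < u"
proof (rule ccontr)
  assume "z \<in> set_decode u" "\<not> z < u"
  then have "u < 2 ^ z" by (meson le_less_trans less_exp linorder_not_less)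
  with \<open>z \<in> set_decode u\<close> show False by (simp add: set_decode_def)
qed

text \<open>The subprograms and intermediate values are searched for without bound. Semidecidability
  suffices, since traces occur only positively in what follows.\<close>

lemma semidecidable_in_justified:
  assumes "computable_in A u" "computable_in A e" "computable_in A x" "computable_in A y"
  shows "semidecidable_in A (\<lambda>w. justified (set_decode (u w)) (e w) (x w) (y w))"
proof -
  have "semidecidable_in A (\<lambda>w. justified (set_decode (pfst (pfst w))) (psnd (pfst w))
      (pfst (psnd w)) (psnd (psnd w)))"
    unfolding justified_def entry_def
    by (intro semidecidable_in_disj semidecidable_in_conj semidecidable_in_ex
        semidecidable_in_all_less;
        intro semidecidable_in_decidable decidable_in_intros computable_in_intros)
  from semidecidable_in_compose[OF this
      computable_in_pair[OF computable_in_pair[OF assms(1,2)] computable_in_pair[OF assms(3,4)]]]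
  show ?thesis by simp
qed

lemma semidecidable_in_trace: "semidecidable_in A (\<lambda>u. is_trace (set_decode u))"
proof -
  have "is_trace (set_decode u) \<longleftrightarrow> (\<forall>z<u. z \<in> set_decode u \<longrightarrow>
      justified (set_decode u) (pfst z) (pfst (psnd z)) (psnd (psnd z)))" for u
    unfolding is_trace_def entry_def
    by (metis encode_pfst_psnd less_of_mem_set_decode pfst_encode psnd_encode)
  moreover have "semidecidable_in A (\<lambda>u. \<forall>z<u. z \<in> set_decode u \<longrightarrow>
      justified (set_decode u) (pfst z) (pfst (psnd z)) (psnd (psnd z)))"
    by (intro semidecidable_in_all_less semidecidable_in_imp semidecidable_in_justified
        decidable_in_intros computable_in_intros)
  ultimately show ?thesis by simp
qed

text \<open>\<open>B\<close> will be \<open>A\<close> itself for enumerations with the oracle, and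
  empty for the oracle-free programs that come with the metric and the transformation.\<close>

lemma semidecidable_in_phi:
  assumes "decidable_in A (\<lambda>x. x \<in> B)"
    and "computable_in A e" "computable_in A x" "computable_in A y"
  shows "semidecidable_in A (\<lambda>w. phi B (e w) (x w) (y w))"
proof -
  have *: "correct_queries B (set_decode u) \<longleftrightarrow> (\<forall>z<u. z \<in> set_decode u \<longrightarrow> pfst z = 4 \<longrightarrow>
      (pfst (psnd z) \<in> B \<longrightarrow> psnd (psnd z) = 1) \<and> (pfst (psnd z) \<notin> B \<longrightarrow> psnd (psnd z) = 0))" for u
    unfolding correct_queries_def entry_def of_bool_def
    by (metis encode_pfst_psnd less_of_mem_set_decode pfst_encode psnd_encode)
  have "semidecidable_in A (\<lambda>w. phi B (pfst w) (pfst (psnd w)) (psnd (psnd w)))"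
    unfolding phi_iff_trace entry_def *
    by (intro semidecidable_in_ex semidecidable_in_conj
        semidecidable_in_compose[OF semidecidable_in_trace];
        intro semidecidable_in_decidable decidable_in_intros decidable_in_compose[OF assms(1)]
        computable_in_intros)
  from semidecidable_in_compose[OF this computable_in_pair[OF assms(2) computable_in_pair[OF assms(3,4)]]]
  show ?thesis by simp
qed

lemma semidecidable_in_ce_set:
  assumes "computable_in A x" "computable_in A e"
  shows "semidecidable_in A (\<lambda>w. x w \<in> ce_set A (e w))"
proof -
  have "decidable_in A (\<lambda>x. x \<in> A)"
    by (intro decidable_in_oracle computable_in_id)
  then have "semidecidable_in A (\<lambda>w. \<exists>y. phi A (e w) (x w) y)"
    by (intro semidecidable_in_ex semidecidable_in_phi computable_in_compose[OF assms(1)]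
        computable_in_compose[OF assms(2)] computable_in_intros)
  then show ?thesis by (simp add: ce_set_def)
qed

lemma decidable_in_empty: "decidable_in A (\<lambda>x. x \<in> {})"
  using decidable_in_less[OF computable_in_const[of A 1] computable_in_const[of A 0]] by simp

lemma semidecidable_in_ce_set_empty:
  assumes "computable_in A x" "computable_in A e"
  shows "semidecidable_in A (\<lambda>w. x w \<in> ce_set {} (e w))"
proof -
  have "semidecidable_in A (\<lambda>w. \<exists>y. phi {} (e w) (x w) y)"
    by (intro semidecidable_in_ex semidecidable_in_phi decidable_in_empty
        computable_in_compose[OF assms(1)] computable_in_compose[OF assms(2)] computable_in_intros)
  then show ?thesis by (simp add: ce_set_def)
qed

lemma semidecidable_in_turing_jump:
  "computable_in A f \<Longrightarrow> semidecidable_in A (\<lambda>w. f w \<in> turing_jump A)"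
  unfolding turing_jump_def by (simp add: semidecidable_in_ce_set)

text \<open>
  Sets that are c.e. in the jump are \<open>\<Sigma>\<^sub>2\<close>: the queries with a positive answer in a trace can be
  confirmed, the negative answers can only be refuted.
\<close>

lemma ce_set_turing_jump:
  obtains R N where
    "semidecidable_in A (\<lambda>w. R (pfst w) (pfst (psnd w)) (psnd (psnd w)))"
    "semidecidable_in A N"
    "\<And>e x. x \<in> ce_set (turing_jump A) e \<longleftrightarrow> (\<exists>t. R e x t \<and> \<not> N t)"
proof
  let ?J = "turing_jump A"
  \<comment> \<open>t packs the code of a trace with the output. \<open>?R\<close> confirms the
    answers 1, while \<open>?N\<close> detects a wrong answer 0 and depends on t alone.\<close>
  let ?R = "\<lambda>e x t. is_trace (set_decode (pfst t)) \<and> prod_encode (e, prod_encode (x, psnd t)) \<in> set_decode (pfst t) \<and>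
      (\<forall>z<pfst t. z \<in> set_decode (pfst t) \<longrightarrow> pfst z = 4 \<longrightarrow> psnd (psnd z) \<noteq> 0 \<longrightarrow> pfst (psnd z) \<in> ?J)"
  let ?N = "\<lambda>t. \<exists>z. z \<in> set_decode (pfst t) \<and> pfst z = 4 \<and> psnd (psnd z) = 0 \<and> pfst (psnd z) \<in> ?J"
  show "semidecidable_in A (\<lambda>w. ?R (pfst w) (pfst (psnd w)) (psnd (psnd w)))"
    by (intro semidecidable_in_conj semidecidable_in_all_less semidecidable_in_imp
        semidecidable_in_turing_jump semidecidable_in_compose[OF semidecidable_in_trace];
        intro semidecidable_in_decidable decidable_in_intros computable_in_intros)
  show "semidecidable_in A ?N"
    by (intro semidecidable_in_conj semidecidable_in_ex semidecidable_in_turing_jump;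
        intro semidecidable_in_decidable decidable_in_intros computable_in_intros)
  have *: "correct_queries ?J (set_decode u) \<longleftrightarrow>
      (\<forall>z<u. z \<in> set_decode u \<longrightarrow> pfst z = 4 \<longrightarrow> psnd (psnd z) \<noteq> 0 \<longrightarrow> pfst (psnd z) \<in> ?J) \<and>
      \<not> (\<exists>z. z \<in> set_decode u \<and> pfst z = 4 \<and> psnd (psnd z) = 0 \<and> pfst (psnd z) \<in> ?J)"
    if "is_trace (set_decode u)" for u
  proof -
    \<comment> \<open>Answers in a trace are bits, so a nonzero answer is 1.\<close>
    have "psnd (psnd z) < 2" if "z \<in> set_decode u" "pfst z = 4" for z
    proof -
      have "justified (set_decode u) 4 (pfst (psnd z)) (psnd (psnd z))"
        using \<open>is_trace (set_decode u)\<close> that entry_surj[of z] unfolding is_trace_def by metis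
      then show ?thesis by (auto simp: justified_def)
    qed
    then have "psnd (psnd z) = 0 \<or> psnd (psnd z) = 1" if "z \<in> set_decode u" "pfst z = 4" for z
      using that by fastforce
    moreover have "correct_queries ?J (set_decode u) \<longleftrightarrow>
        (\<forall>z. z \<in> set_decode u \<longrightarrow> pfst z = 4 \<longrightarrow> psnd (psnd z) = of_bool (pfst (psnd z) \<in> ?J))"
      unfolding correct_queries_def entry_def by (metis encode_pfst_psnd pfst_encode psnd_encode)
    ultimately show ?thesis
      using less_of_mem_set_decode by (smt (verit) of_bool_eq zero_neq_one)
  qed
  show "x \<in> ce_set ?J e \<longleftrightarrow> (\<exists>t. ?R e x t \<and> \<not> ?N t)" for e x
  proof -
    have "x \<in> ce_set ?J e \<longleftrightarrow> (\<exists>y u. is_trace (set_decode u) \<and> entry e x y \<in> set_decode u \<and>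
       correct_queries ?J (set_decode u))"
      by (auto simp: ce_set_def phi_iff_trace)
    also have "\<dots> \<longleftrightarrow> (\<exists>t. is_trace (set_decode (pfst t)) \<and> entry e x (psnd t) \<in> set_decode (pfst t) \<and>
       correct_queries ?J (set_decode (pfst t)))"
      by (metis pfst_encode psnd_encode)
    also have "\<dots> \<longleftrightarrow> (\<exists>t. ?R e x t \<and> \<not> ?N t)"
      unfolding entry_def using * by blast
    finally show ?thesis .
  qed
qed


section \<open>The effective Borel hierarchy\<close>

lemma pos_rat_enum_eq: "pos_rat_enum j = real (Suc (pfst j)) / real (Suc (psnd j))"
  by (simp add: pos_rat_enum_def pfst_def psnd_def split: prod.split)

lemma rat_enum_eq: "rat_enum m = real_of_int (int_decode (pfst m)) / real (Suc (psnd m))"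
  by (simp add: rat_enum_def pfst_def psnd_def split: prod.split)

lemma pos_rat_enum_pos: "0 < pos_rat_enum j"
  by (simp add: pos_rat_enum_eq)

lemma ideal_ball_eq: "ideal_ball s m = ball (s (pfst m)) (pos_rat_enum (psnd m))"
  by (simp add: ideal_ball_def pfst_def psnd_def split: prod.split)

lemma pos_rat_enum_dense:
  assumes "0 \<le> x" "x < y"
  obtains j where "x < pos_rat_enum j" "pos_rat_enum j < y"
proof -
  obtain r where "r \<in> \<rat>" "x < r" "r < y"
    using Rats_dense_in_real[OF assms(2)] by blast
  then obtain i n where r: "r = real_of_int i / real n" "n \<noteq> 0"
    unfolding Rats_eq_int_div_nat by blast
  have "0 < r" using assms(1) \<open>x < r\<close> by simp
  then have "0 < i" using r by (simp add: zero_less_divide_iff)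
  then have "real (Suc (nat i - 1)) = real_of_int i" by simp
  moreover have "Suc (n - 1) = n" using r(2) by simp
  ultimately have "pos_rat_enum (prod_encode (nat i - 1, n - 1)) = r"
    by (simp only: pos_rat_enum_eq pfst_encode psnd_encode r)
  with \<open>x < r\<close> \<open>r < y\<close> show ?thesis using that by metis
qed

lemma decidable_in_pos_rat_enum_less:
  assumes "computable_in A f" "computable_in A g"
  shows "decidable_in A (\<lambda>w. pos_rat_enum (f w) < pos_rat_enum (g w))"
proof -
  have "pos_rat_enum i < pos_rat_enum j \<longleftrightarrow>
      Suc (pfst i) * Suc (psnd j) < Suc (pfst j) * Suc (psnd i)" for i j
    unfolding pos_rat_enum_eq
    by (simp add: divide_less_eq less_divide_eq del: of_nat_Suc flip: of_nat_mult)
  moreover have "decidable_in A (\<lambda>w. Suc (pfst (f w)) * Suc (psnd (g w)) <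
      Suc (pfst (g w)) * Suc (psnd (f w)))"
    by (intro decidable_in_intros computable_in_intros assms)
  ultimately show ?thesis by simp
qed

text \<open>Clearing denominators leaves an inequality between natural numbers.
  \<open>int_decode\<close> sends an even code 2c to c and odd codes to negative integers, and a
  negative rational cannot exceed the positive left-hand side.\<close>

lemma rat_enum_gt_iff:
  "pos_rat_enum i + pos_rat_enum j < rat_enum m - 1 / 2 ^ k \<longleftrightarrow>
     (\<exists>c<Suc (pfst m). pfst m = 2 * c \<and>
        Suc (psnd m) * (Suc (psnd i) * Suc (psnd j) + 2 ^ k *
          (Suc (pfst i) * Suc (psnd j) + Suc (pfst j) * Suc (psnd i))) <
        c * 2 ^ k * (Suc (psnd i) * Suc (psnd j)))"
    (is "?L \<longleftrightarrow> ?R")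
proof (cases "even (pfst m)")
  case True
  then obtain c where c: "pfst m = 2 * c" by (auto elim: evenE)
  define a where "a = real (Suc (psnd i))"
  define b where "b = real (Suc (psnd j))"
  define a' where "a' = real (Suc (pfst i))"
  define b' where "b' = real (Suc (pfst j))"
  define d where "d = real (Suc (psnd m))"
  have pos: "0 < a" "0 < b" "0 < d" by (simp_all add: a_def b_def d_def)
  have "int_decode (pfst m) = int c"
    using c by (simp add: int_decode_def sum_decode_def)
  then have rat: "rat_enum m = real c / d"
    by (simp add: rat_enum_eq d_def)
  have "?L \<longleftrightarrow> a' / a + b' / b + 1 / 2 ^ k < real c / d"
    unfolding rat pos_rat_enum_eq a_def b_def a'_def b'_def by linarith
  also have "a' / a + b' / b + 1 / 2 ^ k = (a * b + 2 ^ k * (a' * b + b' * a)) / (a * b * 2 ^ k)"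
    using pos by (simp add: field_simps)
  also have "\<dots> < real c / d \<longleftrightarrow>
      d * (a * b + 2 ^ k * (a' * b + b' * a)) < real c * 2 ^ k * (a * b)"
    using pos by (simp add: divide_less_eq less_divide_eq mult_ac)
  also have "\<dots> \<longleftrightarrow> real (Suc (psnd m) * (Suc (psnd i) * Suc (psnd j) + 2 ^ k *
          (Suc (pfst i) * Suc (psnd j) + Suc (pfst j) * Suc (psnd i)))) <
        real (c * 2 ^ k * (Suc (psnd i) * Suc (psnd j)))"
    unfolding a_def b_def a'_def b'_def d_def of_nat_mult of_nat_add of_nat_power of_nat_numeral ..
  also have "\<dots> \<longleftrightarrow> ?R"
    unfolding of_nat_less_iff using c by auto
  finally show ?thesis .
next
  case False
  then have "int_decode (pfst m) < 0"
    by (simp add: int_decode_def sum_decode_def)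
  then have "rat_enum m < 0"
    by (simp add: rat_enum_eq divide_neg_pos)
  then have "rat_enum m - 1 / 2 ^ k < 0"
    by (smt (verit) zero_le_divide_1_iff zero_le_power)
  then show ?thesis
    using False pos_rat_enum_pos[of i] pos_rat_enum_pos[of j] by auto
qed

lemma semidecidable_in_dist_gt:
  assumes "computable_metric_space s"
    and "computable_in A a" "computable_in A b" "computable_in A i" "computable_in A j"
  shows "semidecidable_in A
    (\<lambda>w. pos_rat_enum (i w) + pos_rat_enum (j w) < dist (s (a w)) (s (b w)))"
proof -
  obtain h where h: "computable h"
    "\<And>p. case prod_decode p of (i, j) \<Rightarrow> computable_real_index (h p) (dist (s i) (s j))"
    using assms(1) by (auto simp: computable_metric_space_def uniformly_def)
  have idx: "computable_real_index (h (prod_encode (a, b))) (dist (s a) (s b))" for a b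
    using h(2)[of "prod_encode (a, b)"] by simp
  have *: "pos_rat_enum i + pos_rat_enum j < dist (s a) (s b) \<longleftrightarrow>
      (\<exists>k m. phi {} (h (prod_encode (a, b))) k m \<and>
        pos_rat_enum i + pos_rat_enum j < rat_enum m - 1 / 2 ^ k)" (is "?L \<longleftrightarrow> ?R") for a b i j
  proof
    assume ?L
    \<comment> \<open>Half the gap is taken because 1 / 2^k is lost twice, once as approximation
      error and once in the subtracted term.\<close>
    then have "0 < (dist (s a) (s b) - (pos_rat_enum i + pos_rat_enum j)) / 2" by simp
    from real_arch_pow_inv[OF this, of "1 / 2"]
    obtain k where "(1 / 2) ^ k < (dist (s a) (s b) - (pos_rat_enum i + pos_rat_enum j)) / 2"
      by auto
    then have k: "1 / 2 ^ k < (dist (s a) (s b) - (pos_rat_enum i + pos_rat_enum j)) / 2"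
      by (simp only: power_one_over)
    obtain m where "phi {} (h (prod_encode (a, b))) k m"
      and "\<bar>dist (s a) (s b) - rat_enum m\<bar> \<le> 1 / 2 ^ k"
      using idx unfolding computable_real_index_def by blast
    moreover from this(2) k have "pos_rat_enum i + pos_rat_enum j < rat_enum m - 1 / 2 ^ k"
      by argo
    ultimately show ?R by blast
  next
    assume ?R
    then obtain k m where km: "phi {} (h (prod_encode (a, b))) k m"
      "pos_rat_enum i + pos_rat_enum j < rat_enum m - 1 / 2 ^ k" by blast
    obtain m' where "phi {} (h (prod_encode (a, b))) k m'"
      and m': "\<bar>dist (s a) (s b) - rat_enum m'\<bar> \<le> 1 / 2 ^ k"
      using idx unfolding computable_real_index_def by blast
    with km have "m' = m"
      unfolding phi_def by (metis computes_deterministic goedel_inject)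
    then show ?L
      using m' km(2) by simp
  qed
  have h': "computable_in A h" using h(1) by (rule computable_imp_computable_in)
  have "semidecidable_in A (\<lambda>w. pos_rat_enum (pfst (pfst w)) + pos_rat_enum (psnd (pfst w)) <
      dist (s (pfst (psnd w))) (s (psnd (psnd w))))"
    unfolding * rat_enum_gt_iff
    by (intro semidecidable_in_ex semidecidable_in_conj semidecidable_in_phi decidable_in_empty
        computable_in_compose[OF h'] computable_in_intros
        semidecidable_in_decidable[OF decidable_in_ex_less] decidable_in_conj decidable_in_eq
        decidable_in_less)
  from semidecidable_in_compose[OF this
      computable_in_pair[OF computable_in_pair[OF assms(4,5)] computable_in_pair[OF assms(2,3)]]]
  show ?thesis by simp
qed

section \<open>Open sets as unions of closed balls\<close>

lemma dense_nearby:
  assumes "computable_metric_space s" "0 < \<epsilon>"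
  obtains a where "dist (s a) y < \<epsilon>"
proof -
  have "y \<in> closure (range s)" using assms(1) by (simp add: computable_metric_space_def)
  then show ?thesis using assms(2) that unfolding closure_approachable by blast
qed

text \<open>The complement is the union of the ideal balls whose centre is farther from
  \<open>s i\<close> than the sum of the two radii, a semidecidable condition.\<close>

lemma sigma0_complement_cball:
  assumes "computable_metric_space s"
  obtains g where "computable_in A g"
    "\<And>i j. sigma0_set s A 1 (g (prod_encode (i, j))) = - cball (s i) (pos_rat_enum j)"
proof -
  have "semidecidable_in A (\<lambda>w. pos_rat_enum (psnd (pfst w)) + pos_rat_enum (psnd (psnd w)) <
      dist (s (pfst (pfst w))) (s (pfst (psnd w))))"
    by (intro semidecidable_in_dist_gt assms computable_in_intros)
  from smn[OF this] obtain g where g: "computable_in A g" "\<And>z. ce_set A (g z) =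
      {m. pos_rat_enum (psnd z) + pos_rat_enum (psnd m) < dist (s (pfst z)) (s (pfst m))}"
    by blast
  have "sigma0_set s A 1 (g (prod_encode (i, j))) = - cball (s i) (pos_rat_enum j)" for i j
  proof (intro equalityI subsetI)
    fix y
    assume "y \<in> sigma0_set s A 1 (g (prod_encode (i, j)))"
    then obtain m where m: "pos_rat_enum j + pos_rat_enum (psnd m) < dist (s i) (s (pfst m))"
      "dist (s (pfst m)) y < pos_rat_enum (psnd m)"
      by (auto simp: g(2) ideal_ball_eq)
    with dist_triangle2[of "s i" "s (pfst m)" y] show "y \<in> - cball (s i) (pos_rat_enum j)"
      by (simp add: dist_commute)
  next
    fix y
    assume "y \<in> - cball (s i) (pos_rat_enum j)"
    \<comment> \<open>With the centre within half the gap of y and the radius between that distance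
      and half the gap, the new ball contains y and still passes the test.\<close>
    then have "0 < (dist (s i) y - pos_rat_enum j) / 2" by simp
    then obtain a where a: "dist (s a) y < (dist (s i) y - pos_rat_enum j) / 2"
      using dense_nearby[OF assms] by blast
    then obtain b where b: "dist (s a) y < pos_rat_enum b"
      "pos_rat_enum b < (dist (s i) y - pos_rat_enum j) / 2"
      using pos_rat_enum_dense[OF zero_le_dist] by blast
    have "pos_rat_enum j + pos_rat_enum b < dist (s i) (s a)"
      using b dist_triangle[of "s i" y "s a"] by (simp add: field_simps)
    with b show "y \<in> sigma0_set s A 1 (g (prod_encode (i, j)))"
      by (auto simp: g(2) ideal_ball_eq intro!: exI[of _ "prod_encode (a, b)"])
  qed
  with g(1) show ?thesis using that by blast
qed

lemma ball_eq_Union_cball: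
  "ball c (pos_rat_enum j) = (\<Union>j'\<in>{j'. pos_rat_enum j' < pos_rat_enum j}. cball c (pos_rat_enum j'))"
proof (intro equalityI subsetI)
  fix y
  assume "y \<in> ball c (pos_rat_enum j)"
  then obtain j' where "dist c y < pos_rat_enum j'" "pos_rat_enum j' < pos_rat_enum j"
    using pos_rat_enum_dense[OF zero_le_dist] by (metis mem_ball)
  then show "y \<in> (\<Union>j'\<in>{j'. pos_rat_enum j' < pos_rat_enum j}. cball c (pos_rat_enum j'))"
    by (auto intro: less_imp_le)
qed auto

text \<open>An open ball is the union of the concentric closed balls of smaller rational radius.
  Closed balls are Pi_1 already relative to \<open>A\<close>, so the oracle \<open>B\<close> is
  spent only on enumerating them.\<close>

lemma sigma0_1_as_Union:
  assumes "computable_metric_space s"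
  obtains g v where "computable_in A g" "computable_in A v"
    "\<And>e. sigma0_set s B 1 e = (\<Union>i\<in>ce_set B (v e). - sigma0_set s A 1 (g i))"
proof -
  obtain g where g: "computable_in A g"
    "\<And>i j. sigma0_set s A 1 (g (prod_encode (i, j))) = - cball (s i) (pos_rat_enum j)"
    using sigma0_complement_cball[OF assms] by blast
  have "semidecidable_in B (\<lambda>w. pfst (psnd w) \<in> ce_set B (pfst w) \<and>
      pos_rat_enum (psnd (psnd w)) < pos_rat_enum (psnd (pfst (psnd w))))"
    by (intro semidecidable_in_conj semidecidable_in_ce_set semidecidable_in_decidable
        decidable_in_pos_rat_enum_less computable_in_intros)
  from smn[OF this] obtain v where v: "computable_in A v" "\<And>e. ce_set B (v e) =
      {x. pfst x \<in> ce_set B e \<and> pos_rat_enum (psnd x) < pos_rat_enum (psnd (pfst x))}"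
    by blast
  let ?g = "\<lambda>x. g (prod_encode (pfst (pfst x), psnd x))"
  have "sigma0_set s B 1 e = (\<Union>i\<in>ce_set B (v e). - sigma0_set s A 1 (?g i))" for e
  proof -
    have "sigma0_set s B 1 e = (\<Union>m\<in>ce_set B e.
        \<Union>j\<in>{j. pos_rat_enum j < pos_rat_enum (psnd m)}. cball (s (pfst m)) (pos_rat_enum j))"
      by (simp add: ideal_ball_eq ball_eq_Union_cball)
    also have "\<dots> = (\<Union>x\<in>ce_set B (v e). cball (s (pfst (pfst x))) (pos_rat_enum (psnd x)))"
      unfolding v(2)
    proof (intro equalityI subsetI)
      fix y
      assume "y \<in> (\<Union>m\<in>ce_set B e. \<Union>j\<in>{j. pos_rat_enum j < pos_rat_enum (psnd m)}.
          cball (s (pfst m)) (pos_rat_enum j))"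
      then obtain m j where "m \<in> ce_set B e" "pos_rat_enum j < pos_rat_enum (psnd m)"
        "y \<in> cball (s (pfst m)) (pos_rat_enum j)" by blast
      then show "y \<in> (\<Union>x\<in>{x. pfst x \<in> ce_set B e \<and>
          pos_rat_enum (psnd x) < pos_rat_enum (psnd (pfst x))}.
          cball (s (pfst (pfst x))) (pos_rat_enum (psnd x)))"
        by (intro UN_I[of "prod_encode (m, j)"]) auto
    qed blast
    finally show ?thesis by (simp only: g(2) double_complement)
  qed
  moreover have "computable_in A ?g"
    by (intro computable_in_compose[OF g(1)] computable_in_intros)
  ultimately show ?thesis using that v(1) by blast
qed

text \<open>At level 1 the ideal balls cover the space by density; above it, some enumerated index
  belongs to the empty set, whose complement is everything.\<close>

lemma sigma0_set_UNIV:
  assumes "computable_metric_space s" "ce_set A e = UNIV"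
  shows "sigma0_set s A (Suc k) e = UNIV"
proof (cases k)
  case 0
  have "y \<in> (\<Union>i. ideal_ball s i)" for y
  proof -
    obtain a where "dist (s a) y < pos_rat_enum 0"
      using dense_nearby[OF assms(1) pos_rat_enum_pos] .
    then have "y \<in> ideal_ball s (prod_encode (a, 0))" by (simp add: ideal_ball_eq)
    then show ?thesis by blast
  qed
  with 0 assms(2) show ?thesis by auto
next
  case (Suc k')
  obtain j where "ce_set A j = {}"
    using semidecidable_in_imp_ce_set[OF semidecidable_in_decidable[OF decidable_in_empty]] by auto
  then have "sigma0_set s A (Suc k') j = {}" by (cases k') simp_all
  then show ?thesis using Suc assms(2) by auto
qed

text \<open>
  A negative query to the jump that turns out to be wrong enlarges the \<open>\<Sigma>\<^sub>k\<close> set in question to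
  the whole space, so that the corresponding \<open>\<Pi>\<^sub>k\<close> set drops out of the union.
\<close>

lemma sigma0_Union_over_jump:
  assumes "computable_metric_space s" "computable_in A h"
  obtains h' where "computable_in A h'"
    "\<And>e. sigma0_set s A (Suc (Suc k)) (h' e) =
      (\<Union>i\<in>ce_set (turing_jump A) e. - sigma0_set s A (Suc k) (h i))"
proof -
  obtain R N where R: "semidecidable_in A (\<lambda>w. R (pfst w) (pfst (psnd w)) (psnd (psnd w)))"
    and N: "semidecidable_in A N"
    and jump: "\<And>e x. x \<in> ce_set (turing_jump A) e \<longleftrightarrow> (\<exists>t. R e x t \<and> \<not> N t)"
    using ce_set_turing_jump[of A] by blast
  have "semidecidable_in A (\<lambda>w. psnd w \<in> ce_set A (h (pfst (pfst w))) \<or> N (psnd (pfst w)))"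
    by (intro semidecidable_in_disj semidecidable_in_ce_set semidecidable_in_compose[OF N]
        computable_in_compose[OF assms(2)] computable_in_intros)
  from smn[OF this] obtain g where g: "computable_in A g"
    "\<And>z. ce_set A (g z) = {x. x \<in> ce_set A (h (pfst z)) \<or> N (psnd z)}" by blast
  have sigma_g: "sigma0_set s A (Suc k) (g z) =
      (if N (psnd z) then UNIV else sigma0_set s A (Suc k) (h (pfst z)))" for z
  proof (cases "N (psnd z)")
    case True
    then show ?thesis by (simp add: g(2) sigma0_set_UNIV[OF assms(1)])
  next
    case False
    then have "ce_set A (g z) = ce_set A (h (pfst z))" by (simp add: g(2))
    with False show ?thesis by (cases k) simp_all
  qed
  have "semidecidable_in A (\<lambda>w. \<exists>z. R (pfst w) (pfst z) (psnd z) \<and> psnd w = g z)"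
  proof (intro semidecidable_in_ex semidecidable_in_conj)
    show "semidecidable_in A (\<lambda>z. R (pfst (pfst z)) (pfst (psnd z)) (psnd (psnd z)))"
      using semidecidable_in_compose[OF R, of "\<lambda>z. prod_encode (pfst (pfst z), psnd z)"]
      by (simp add: computable_in_intros)
    show "semidecidable_in A (\<lambda>z. psnd (pfst z) = g (psnd z))"
      by (intro semidecidable_in_decidable decidable_in_intros computable_in_compose[OF g(1)]
          computable_in_intros)
  qed
  from smn[OF this] obtain h' where h': "computable_in A h'"
    "\<And>e. ce_set A (h' e) = {x. \<exists>z. R e (pfst z) (psnd z) \<and> x = g z}" by blast
  have "sigma0_set s A (Suc (Suc k)) (h' e) =
      (\<Union>i\<in>ce_set (turing_jump A) e. - sigma0_set s A (Suc k) (h i))" for e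
  proof -
    have "sigma0_set s A (Suc (Suc k)) (h' e) =
        (\<Union>z\<in>{z. R e (pfst z) (psnd z)}. - sigma0_set s A (Suc k) (g z))"
      by (auto simp del: sigma0_set.simps simp: sigma0_set.simps(3) h'(2))
    also have "\<dots> = (\<Union>i\<in>ce_set (turing_jump A) e. - sigma0_set s A (Suc k) (h i))"
    proof (intro equalityI subsetI)
      fix y
      assume "y \<in> (\<Union>z\<in>{z. R e (pfst z) (psnd z)}. - sigma0_set s A (Suc k) (g z))"
      then obtain z where "R e (pfst z) (psnd z)" "\<not> N (psnd z)"
        "y \<notin> sigma0_set s A (Suc k) (h (pfst z))"
        unfolding sigma_g by (auto split: if_splits)
      then show "y \<in> (\<Union>i\<in>ce_set (turing_jump A) e. - sigma0_set s A (Suc k) (h i))"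
        using jump by blast
    next
      fix y
      assume "y \<in> (\<Union>i\<in>ce_set (turing_jump A) e. - sigma0_set s A (Suc k) (h i))"
      then obtain i t where "R e i t" "\<not> N t" "y \<notin> sigma0_set s A (Suc k) (h i)"
        using jump by blast
      then show "y \<in> (\<Union>z\<in>{z. R e (pfst z) (psnd z)}. - sigma0_set s A (Suc k) (g z))"
        unfolding sigma_g by (intro UN_I[of "prod_encode (i, t)"]) auto
    qed
    finally show ?thesis .
  qed
  with h'(1) show ?thesis using that by blast
qed

text \<open>The induction must carry an \<open>A\<close>-computable translation of indices, because
  in the next step it is applied to every member of an enumerated union.\<close>

lemma sigma0_set_turing_jump:
  assumes "computable_metric_space s"
  shows "\<exists>h. computable_in A h \<and>
    (\<forall>e. sigma0_set s (turing_jump A) (Suc k) e = sigma0_set s A (Suc (Suc k)) (h e))"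
proof (induction k)
  case 0
  obtain g v where g: "computable_in A g" and v: "computable_in A v"
    and eq: "\<And>e. sigma0_set s (turing_jump A) 1 e =
      (\<Union>i\<in>ce_set (turing_jump A) (v e). - sigma0_set s A 1 (g i))"
    using sigma0_1_as_Union[OF assms] by metis
  obtain h where h: "computable_in A h" "\<And>e. sigma0_set s A (Suc (Suc 0)) (h e) =
      (\<Union>i\<in>ce_set (turing_jump A) e. - sigma0_set s A (Suc 0) (g i))"
    using sigma0_Union_over_jump[OF assms g] by blast
  then show ?case
    using eq computable_in_compose[OF h(1) v]
    by (intro exI[of _ "\<lambda>e. h (v e)"]) (simp del: sigma0_set.simps)
next
  case (Suc k)
  then obtain h where h: "computable_in A h"
    "\<And>e. sigma0_set s (turing_jump A) (Suc k) e = sigma0_set s A (Suc (Suc k)) (h e)" by blast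
  obtain h' where "computable_in A h'" "\<And>e. sigma0_set s A (Suc (Suc (Suc k))) (h' e) =
      (\<Union>i\<in>ce_set (turing_jump A) e. - sigma0_set s A (Suc (Suc k)) (h i))"
    using sigma0_Union_over_jump[OF assms h(1)] by blast
  then show ?case
    by (intro exI[of _ h']) (simp del: sigma0_set.simps add: sigma0_set.simps(3)[of s "turing_jump A"] h(2))
qed

lemma is_sigma0_jumps:
  assumes "computable_metric_space s"
  shows "is_sigma0 s ((turing_jump ^^ m) A) (Suc k) U \<Longrightarrow> is_sigma0 s A (Suc (k + m)) U"
proof (induction m arbitrary: k)
  case (Suc m)
  from Suc.prems obtain e where "U = sigma0_set s (turing_jump ((turing_jump ^^ m) A)) (Suc k) e"
    by (auto simp: is_sigma0_def simp del: sigma0_set.simps)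
  then have "is_sigma0 s ((turing_jump ^^ m) A) (Suc (Suc k)) U"
    using sigma0_set_turing_jump[OF assms, of "(turing_jump ^^ m) A" k]
    unfolding is_sigma0_def by metis
  from Suc.IH[OF this] show ?case by simp
qed simp


section \<open>Iterates of a transformation\<close>

text \<open>A single function \<open>p\<close> turns an index of an open set into one of its
  preimage, so the k-th preimage has index \<open>(p ^^ k) e\<close>. Invariance of \<open>D\<close>
  keeps the agreement on \<open>D\<close> valid along the orbit.\<close>

lemma preimage_iterates:
  assumes "computable_transformation s D T" "\<forall>x\<in>D. T x \<in> D"
  obtains w where "computable_in A w"
    "\<And>k y. y \<in> D \<Longrightarrow> (T ^^ k) y \<in> sigma0_set s A 1 e \<longleftrightarrow> y \<in> sigma0_set s A 1 (w k)"
proof -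
  obtain t where t: "computable t"
    "\<And>i. T -` ideal_ball s i \<inter> D = D \<inter> sigma0_set s {} 1 (t i)"
    using assms(1) by (auto simp: computable_transformation_def uniformly_def)
  have "semidecidable_in A (\<lambda>w. \<exists>i. i \<in> ce_set A (pfst w) \<and> psnd w \<in> ce_set {} (t i))"
    by (intro semidecidable_in_ex semidecidable_in_conj semidecidable_in_ce_set
        semidecidable_in_ce_set_empty computable_in_intros
        computable_in_compose[OF computable_imp_computable_in[OF t(1)]])
  from smn[OF this] obtain p where p: "computable_in A p"
    "\<And>e. ce_set A (p e) = {x. \<exists>i. i \<in> ce_set A e \<and> x \<in> ce_set {} (t i)}"
    by blast
  have step: "T y \<in> sigma0_set s A 1 e \<longleftrightarrow> y \<in> sigma0_set s A 1 (p e)" if "y \<in> D" for y e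
  proof -
    have "T y \<in> ideal_ball s i \<longleftrightarrow> y \<in> sigma0_set s {} 1 (t i)" for i
      using t(2)[of i] that by blast
    then show ?thesis by (auto simp: p(2))
  qed
  have "(T ^^ k) y \<in> sigma0_set s A 1 e \<longleftrightarrow> y \<in> sigma0_set s A 1 ((p ^^ k) e)" if "y \<in> D" for k y
    using that
  proof (induction k arbitrary: y)
    case (Suc k)
    have "(T ^^ Suc k) y = (T ^^ k) (T y)"
      by (simp only: funpow_Suc_right comp_apply)
    moreover have "(T ^^ k) (T y) \<in> sigma0_set s A 1 e \<longleftrightarrow> T y \<in> sigma0_set s A 1 ((p ^^ k) e)"
      using Suc assms(2) by blast
    ultimately show ?case
      using step[OF Suc.prems, of "(p ^^ k) e"] by (simp only: funpow.simps comp_apply)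
  qed simp
  moreover have "computable_in A (\<lambda>k. (p ^^ k) e)"
    by (intro computable_in_funpow p(1) computable_in_intros)
  ultimately show ?thesis using that by blast
qed

text \<open>The preimages of Q under the positive iterates are pairwise disjoint and all have the
  measure of Q, while the total measure is finite.\<close>

lemma wandering_set_null:
  assumes "prob_space \<mu>" "sets \<mu> = sets borel" "measure_preserving_transformation \<mu> D T"
    and "Q \<in> sets borel"
    and wandering: "\<And>y k. y \<in> Q \<Longrightarrow> y \<in> D \<Longrightarrow> (T ^^ Suc k) y \<notin> Q"
  shows "measure \<mu> Q = 0"
proof -
  interpret prob_space \<mu> by fact
  have D: "T y \<in> D" if "y \<in> D" for y
    using assms(3) that by (simp add: measure_preserving_transformation_def)
  have Dk: "(T ^^ k) y \<in> D" if "y \<in> D" for k y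
    using that by (induction k) (auto intro: D)
  have pre: "T -` B \<inter> D \<in> sets borel" "emeasure \<mu> (T -` B \<inter> D) = emeasure \<mu> B"
    if "B \<in> sets borel" for B
    using assms(3) that by (simp_all add: measure_preserving_transformation_def)
  \<comment> \<open>Q may stick out of \<open>D\<close>; from the first preimage on, the sets lie in
    \<open>D\<close> and invariance gives their measure directly.\<close>
  define E where "E k = {y \<in> D. (T ^^ Suc k) y \<in> Q}" for k
  have E_0: "E 0 = T -` Q \<inter> D"
    by (auto simp: E_def)
  have E_Suc: "E (Suc k) = T -` E k \<inter> D" for k
    using D by (auto simp: E_def funpow_swap1)
  have E: "E k \<in> sets borel \<and> emeasure \<mu> (E k) = emeasure \<mu> Q" for k
    by (induction k) (simp_all add: E_0 E_Suc pre assms(4))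
  have "E j \<inter> E l = {}" if "j < l" for j l
  proof (rule ccontr)
    assume "E j \<inter> E l \<noteq> {}"
    then obtain y where y: "y \<in> D" "(T ^^ Suc j) y \<in> Q" "(T ^^ Suc l) y \<in> Q"
      by (auto simp: E_def)
    have "Suc l = Suc (l - Suc j) + Suc j" using that by simp
    then have "(T ^^ Suc l) y = (T ^^ Suc (l - Suc j)) ((T ^^ Suc j) y)"
      by (metis comp_apply funpow_add)
    then show False using wandering[OF y(2) Dk[OF y(1)]] y(3) by simp
  qed
  then have "disjoint_family E"
    unfolding disjoint_family_on_def by (metis inf_commute linorder_neqE_nat)
  then have "(\<lambda>k. measure \<mu> (E k)) sums measure \<mu> (\<Union>k. E k)"
    using E assms(2) by (intro finite_measure_UNION) auto
  moreover have "measure \<mu> (E k) = measure \<mu> Q" for k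
    using E by (simp add: measure_def)
  ultimately have "summable (\<lambda>k::nat. measure \<mu> Q)"
    by (simp add: sums_iff)
  then show ?thesis by (simp add: summable_const_iff)
qed

lemma open_sigma0_1: "is_sigma0 s A 1 U \<Longrightarrow> open U"
  by (auto simp: is_sigma0_def ideal_ball_eq)

section \<open>Recurrence\<close>

theorem theorem3p29:
  fixes s :: "nat \<Rightarrow> 'a::polish_space" and \<mu> :: "'a measure" and n :: nat and A :: "nat set"
    and x :: 'a and P D :: "'a set" and T :: "'a \<Rightarrow> 'a"
  assumes "computable_prob_space s \<mu>"
    and "n \<ge> 1"
    and "pi0_generic s \<mu> n A x"
    and "is_pi0 s A n P" and "x \<in> P" and "measure \<mu> P > 0"
    and "measure_preserving_transformation \<mu> D T"
    and "computable_transformation s D T"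
    and "x \<in> D"
  shows "\<exists>k>0. (T ^^ k) x \<in> P"
proof (rule ccontr)
  assume "\<not> (\<exists>k>0. (T ^^ k) x \<in> P)"
  then have no_return: "(T ^^ Suc k) x \<notin> P" for k by blast
  have cms: "computable_metric_space s" and \<mu>: "prob_space \<mu>" "sets \<mu> = sets borel"
    using assms(1) by (simp_all add: computable_prob_space_def)
  have TD: "\<forall>x\<in>D. T x \<in> D"
    using assms(7) by (simp add: measure_preserving_transformation_def)
  note null = wandering_set_null[OF \<mu> assms(7)]
  show False
  proof (cases "n = 1")
    case True
    obtain U where U: "is_sigma0 s {} 1 U" "U \<subseteq> P" "x \<in> U"
      using assms(3-5) True unfolding pi0_generic_def by auto
    then obtain m where m: "x \<in> ideal_ball s m" "ideal_ball s m \<subseteq> P"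
      by (auto simp: is_sigma0_def)
    \<comment> \<open>The closed ball makes \<open>- W\<close> below a Pi_1 set, while returns are
      still excluded from the whole open ball.\<close>
    then obtain j where j: "x \<in> cball (s (pfst m)) (pos_rat_enum j)"
      "cball (s (pfst m)) (pos_rat_enum j) \<subseteq> ideal_ball s m"
      using ball_eq_Union_cball[of "s (pfst m)" "psnd m"] unfolding ideal_ball_eq by blast
    obtain e where e: "sigma0_set s A 1 e = ideal_ball s m"
    proof -
      have "semidecidable_in A (\<lambda>z. z = m)"
        by (intro semidecidable_in_decidable decidable_in_intros computable_in_intros)
      then obtain e where "ce_set A e = {z. z = m}"
        using semidecidable_in_imp_ce_set by blast
      then show ?thesis using that[of e] by simp
    qed
    obtain w where w: "computable_in A w" "\<And>k y. y \<in> D \<Longrightarrow>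
        (T ^^ k) y \<in> ideal_ball s m \<longleftrightarrow> y \<in> sigma0_set s A 1 (w k)"
      using preimage_iterates[OF assms(8) TD, of A e] unfolding e by blast
    obtain g where g: "sigma0_set s A 1 g = - cball (s (pfst m)) (pos_rat_enum j)"
      using sigma0_complement_cball[OF cms, of A] by metis
    define W where "W = sigma0_set s A 1 g \<union> (\<Union>k. sigma0_set s A 1 (w (Suc k)))"
    have "semidecidable_in A (\<lambda>z. z \<in> ce_set A g \<or> (\<exists>k. z \<in> ce_set A (w (Suc k))))"
      by (intro semidecidable_in_disj semidecidable_in_ex semidecidable_in_ce_set
          computable_in_compose[OF w(1)] computable_in_intros)
    then obtain e' where "ce_set A e' = {z. z \<in> ce_set A g \<or> (\<exists>k. z \<in> ce_set A (w (Suc k)))}"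
      using semidecidable_in_imp_ce_set by blast
    then have "sigma0_set s A 1 e' = W"
      by (auto simp: W_def)
    then have "is_pi0 s A n (- W)"
      unfolding is_pi0_def is_sigma0_def True by auto
    moreover have "x \<notin> W"
      using j(1) w(2)[OF assms(9)] no_return m(2) g unfolding W_def by blast
    ultimately obtain V where V: "is_sigma0 s {} 1 V" "V \<subseteq> - W" "measure \<mu> V > 0"
      using assms(3) True unfolding pi0_generic_def by auto
    have "V \<subseteq> ideal_ball s m"
      using V(2) j(2) g unfolding W_def by blast
    moreover have "V \<in> sets borel"
      using open_sigma0_1[OF V(1)] by simp
    ultimately have "measure \<mu> V = 0"
      \<comment> \<open>V lies in the ideal ball, which points of V in \<open>D\<close> never enter
        again; so they do not return to V.\<close>
      using V(2) w(2) unfolding W_def by (intro null) blast+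
    with V(3) show False by simp
  next
    case False
    define B where "B = (turing_jump ^^ (n - 2)) A"
    obtain Q where Q: "is_pi0 s B 1 Q" "Q \<subseteq> P" "x \<in> Q"
      using assms(3-5) False unfolding pi0_generic_def B_def by auto
    then obtain e where e: "- Q = sigma0_set s B 1 e"
      unfolding is_pi0_def is_sigma0_def by blast
    obtain w where w: "computable_in B w" "\<And>k y. y \<in> D \<Longrightarrow>
        (T ^^ k) y \<in> - Q \<longleftrightarrow> y \<in> sigma0_set s B 1 (w k)"
      using preimage_iterates[OF assms(8) TD, of B e] unfolding e by blast
    \<comment> \<open>On \<open>D\<close>, the k-th set of the union consists of the points whose
      iterate k + 1 lies in Q. These sets are Pi_1 as they stand, but the open set
      \<open>- Q\<close> must first be split into Pi_1 pieces for \<open>R\<close> to be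
      Sigma_2.\<close>
    define R where "R = - Q \<union> (\<Union>k. - sigma0_set s B 1 (w (Suc k)))"
    obtain g v where g: "computable_in B g"
      and v: "sigma0_set s B 1 e = (\<Union>i\<in>ce_set B (v e). - sigma0_set s B 1 (g i))"
      using sigma0_1_as_Union[OF cms, where A = B and B = B] by metis
    have "semidecidable_in B (\<lambda>z. (\<exists>i. i \<in> ce_set B (v e) \<and> z = g i) \<or> (\<exists>k. z = w (Suc k)))"
      by (intro semidecidable_in_disj semidecidable_in_ex semidecidable_in_conj
          semidecidable_in_ce_set;
          intro semidecidable_in_decidable decidable_in_intros
          computable_in_compose[OF w(1)] computable_in_compose[OF g] computable_in_intros)
    then obtain e' where "ce_set B e' = {z. (\<exists>i. i \<in> ce_set B (v e) \<and> z = g i) \<or> (\<exists>k. z = w (Suc k))}"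
      using semidecidable_in_imp_ce_set by blast
    then have "sigma0_set s B (Suc 1) e' = R"
      unfolding R_def e v by (auto simp: One_nat_def)
    then have "is_sigma0 s B (Suc 1) R"
      unfolding is_sigma0_def by blast
    then have "is_sigma0 s A (Suc (1 + (n - 2))) R"
      unfolding B_def by (rule is_sigma0_jumps[OF cms])
    moreover have "Suc (1 + (n - 2)) = n"
      using assms(2) False by simp
    ultimately have "is_pi0 s A n (- R)"
      unfolding is_pi0_def by simp
    moreover have "x \<notin> R"
      using Q(2,3) w(2)[OF assms(9)] no_return unfolding R_def by blast
    ultimately obtain V where V: "is_pi0 s B 1 V" "V \<subseteq> - R" "measure \<mu> V > 0"
      using assms(3) False unfolding pi0_generic_def B_def by auto
    have "open (- V)"
      using V(1) open_sigma0_1 unfolding is_pi0_def by blast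
    then have "V \<in> sets borel" by (simp add: open_closed)
    moreover have "V \<subseteq> Q"
      using V(2) unfolding R_def by blast
    ultimately have "measure \<mu> V = 0"
      using V(2) w(2) unfolding R_def by (intro null) blast+
    with V(3) show False by simp
  qed
qed

end
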